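(* Let $\mathcal{Y}$ be the mild solution of $d\mathcal{Y}(t)=\mathbb{C}\mathcal{Y}(t)\,dt+d\mathcal{L}(t)$, $\mathcal{Y}(0)=\mathcal{Y}_0$. For any $\mathcal{T}\in\mathcal{H}$ and any $t\geq s\geq 0$ it holds that $$ \mathbb{E}\left[e^{\mathrm{i}\langle\mathcal{Y}(t),\mathcal{T}\rangle_{\mathcal{H}}}\,|\,\mathcal{F}_s\right]=\exp\left(\mathrm{i}\langle\mathcal{Y}(s),\mathbb{S}^*(t-s)\mathcal{T}\rangle_{\mathcal{H}}+\int_0^{t-s}\Psi_{\mathcal{L}}(\mathbb{S}^*(u)\mathcal{T})\,du\right). $$
   Context: $(\Omega,\mathcal{F},\{\mathcal{F}_t\}_{t\geq0},P)$ is a filtered probability space. $H$ is a real separable Hilbert space and $\mathcal{H}=L_{\mathrm{HS}}(H)$ is the separable Hilbert space of Hilbert-Schmidt operators on $H$, with inner product $\langle\cdot,\cdot\rangle_{\mathcal{H}}$. $\mathbb{C}\in L(\mathcal{H})$ is a bounded linear operator on $\mathcal{H}$, $\mathbb{S}(t)=\exp(t\mathbb{C})$, $t\ge0$, is the uniformly continuous semigroup it generates, and $\mathbb{S}^*(t)$ is the adjoint of $\mathbb{S}(t)$ in $L(\mathcal{H})$. $\mathcal{L}$ is an $\mathcal{H}$-valued square-integrable Lévy process with respect to $\{\mathcal{F}_t\}$ (i.e. adapted, with $\mathcal{L}(t)-\mathcal{L}(s)$ independent of $\mathcal{F}_s$), and $\mathcal{Y}_0\in\mathcal{H}$. The mild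 solution is $$\mathcal{Y}(t)=\mathbb{S}(t)\mathcal{Y}_0+\int_0^t\mathbb{S}(t-s)\,d\mathcal{L}(s),\quad t\ge0.$$ $\Psi_{\mathcal{L}}$ denotes the cumulant (characteristic exponent) of $\mathcal{L}$: $\mathbb{E}[\exp(\mathrm{i}\langle\mathcal{L}(t),\mathcal{T}\rangle_{\mathcal{H}})]=\exp(t\Psi_{\mathcal{L}}(\mathcal{T}))$, $\mathcal{T}\in\mathcal{H}$, given by $$\Psi_{\mathcal{L}}(\mathcal{T})=\mathrm{i}\langle\mathcal{D},\mathcal{T}\rangle_{\mathcal{H}}-\tfrac12\langle\mathbb{Q}_{\mathcal{L}}^0\mathcal{T},\mathcal{T}\rangle_{\mathcal{H}}+\int_{\mathcal{H}}\left(e^{\mathrm{i}\langle\mathcal{Z},\mathcal{T}\rangle_{\mathcal{H}}}-1-\mathrm{i}\mathbf{1}_{\|\mathcal{Z}\|_{\mathcal{H}}\leq1}\langle\mathcal{Z},\mathcal{T}\rangle_{\mathcal{H}}\right)\nu(d\mathcal{Z}),$$ where $\mathcal{D}\in\mathcal{H}$ is the drift, $\mathbb{Q}^0_{\mathcal{L}}$ the covariance operator of the continuous martingale part, and $\nu$ the Lévy measure of $\mathcal{L}$. *)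

theory Defs
  imports "HOL-Probability.Probability"
begin

section \<open>Orthonormal bases of a separable Hilbert space\<close>

definition orthonormal :: "'a::real_inner set \<Rightarrow> bool" where
  "orthonormal B \<longleftrightarrow> pairwise orthogonal B \<and> (\<forall>e\<in>B. norm e = 1)"

definition onb :: "'a::real_inner set \<Rightarrow> bool" where
  "onb B \<longleftrightarrow> orthonormal B \<and> closure (span B) = UNIV"

lemma orthonormal_inner:
  assumes "orthonormal B" "e \<in> B" "f \<in> B"
  shows "e \<bullet> f = (if e = f then 1 else 0)"
  using assms by (auto simp: orthonormal_def pairwise_def orthogonal_def norm_eq_1)

lemma orthonormal_inner_sum:
  assumes "orthonormal B" "finite F" "F \<subseteq> B" "e \<in> F"
  shows "(\<Sum>f\<in>F. c f *\<^sub>R f) \<bullet> e = c e"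
proof -
  have "(\<Sum>f\<in>F. c f *\<^sub>R f) \<bullet> e = (\<Sum>f\<in>F. c f * (f \<bullet> e))"
    by (simp add: inner_sum_left)
  also have "\<dots> = (\<Sum>f\<in>F. if f = e then c f else 0)"
    by (rule sum.cong) (use assms in \<open>auto simp: orthonormal_inner subset_iff\<close>)
  also have "\<dots> = c e" using assms by simp
  finally show ?thesis .
qed

lemma orthonormal_norm_sum:
  assumes "orthonormal B" "finite F" "F \<subseteq> B"
  shows "(norm (\<Sum>f\<in>F. c f *\<^sub>R f))\<^sup>2 = (\<Sum>f\<in>F. (c f)\<^sup>2)"
proof -
  let ?s = "\<Sum>f\<in>F. c f *\<^sub>R f"
  have "(norm ?s)\<^sup>2 = (\<Sum>e\<in>F. c e * (?s \<bullet> e))"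
    by (simp add: power2_norm_eq_inner inner_sum_right)
  also have "\<dots> = (\<Sum>e\<in>F. (c e)\<^sup>2)"
    by (rule sum.cong) (use orthonormal_inner_sum[OF assms] in \<open>auto simp: power2_eq_square\<close>)
  finally show ?thesis .
qed

lemma orthonormal_best_approx:
  assumes "orthonormal B" "finite F" "F \<subseteq> B"
  shows "norm (x - (\<Sum>f\<in>F. (x \<bullet> f) *\<^sub>R f)) \<le> norm (x - (\<Sum>f\<in>F. c f *\<^sub>R f))"
proof -
  let ?p = "\<Sum>f\<in>F. (x \<bullet> f) *\<^sub>R f" and ?y = "\<Sum>f\<in>F. c f *\<^sub>R f"
  have orth: "(x - ?p) \<bullet> e = 0" if "e \<in> F" for e
    using orthonormal_inner_sum[OF assms that] by (simp add: inner_diff_left)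
  have "(x - ?p) \<bullet> (?p - ?y) = 0"
    by (simp add: inner_diff_right inner_sum_right orth)
  then have "(norm (x - ?y))\<^sup>2 = (norm (x - ?p))\<^sup>2 + (norm (?p - ?y))\<^sup>2"
    by (simp add: power2_norm_eq_inner algebra_simps inner_commute)
  then have "(norm (x - ?p))\<^sup>2 \<le> (norm (x - ?y))\<^sup>2"
    by simp
  then show ?thesis
    by (rule power2_le_imp_le) simp
qed

lemma onb_expansion:
  assumes "onb B"
  shows "((\<lambda>e. (x \<bullet> e) *\<^sub>R e) has_sum x) B"
  unfolding has_sum_def tendsto_iff
proof (intro allI impI)
  fix \<epsilon> :: real assume "\<epsilon> > 0"
  have B: "orthonormal B" using assms by (simp add: onb_def)
  have "x \<in> closure (span B)" using assms by (simp add: onb_def)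
  then obtain y where "y \<in> span B" and y: "dist y x < \<epsilon>"
    using \<open>\<epsilon> > 0\<close> closure_approachable by blast
  then obtain F r where F: "finite F" "F \<subseteq> B" "y = (\<Sum>a\<in>F. r a *\<^sub>R a)"
    by (auto simp: span_explicit)
  have "dist (\<Sum>e\<in>G. (x \<bullet> e) *\<^sub>R e) x < \<epsilon>" if "finite G" "G \<subseteq> B" "F \<subseteq> G" for G
  proof -
    have "y = (\<Sum>a\<in>G. (if a \<in> F then r a else 0) *\<^sub>R a)"
      unfolding F(3) by (rule sum.mono_neutral_cong_left) (use that in auto)
    then have "norm (x - (\<Sum>e\<in>G. (x \<bullet> e) *\<^sub>R e)) \<le> norm (x - y)"
      using orthonormal_best_approx[OF B that(1,2)] by metis
    then show ?thesis using y by (simp add: dist_norm norm_minus_commute)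
  qed
  then show "\<forall>\<^sub>F G in finite_subsets_at_top B. dist (\<Sum>e\<in>G. (x \<bullet> e) *\<^sub>R e) x < \<epsilon>"
    unfolding eventually_finite_subsets_at_top using F by blast
qed

lemma onb_parseval:
  assumes "onb B"
  shows "((\<lambda>e. (x \<bullet> e)\<^sup>2) has_sum (norm x)\<^sup>2) B"
proof -
  have "((\<lambda>e. x \<bullet> ((x \<bullet> e) *\<^sub>R e)) has_sum x \<bullet> x) B"
    by (rule has_sum_bounded_linear[OF bounded_linear_inner_right onb_expansion[OF assms]])
  then show ?thesis unfolding power2_norm_eq_inner by (simp add: power2_eq_square)
qed

lemma orthonormal_extend:
  assumes "orthonormal F" "finite F"
  shows "\<exists>G. orthonormal G \<and> finite G \<and> F \<subseteq> G \<and> d \<in> span G"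
proof -
  let ?p = "\<Sum>f\<in>F. (d \<bullet> f) *\<^sub>R f"
  have p: "?p \<in> span F" by (intro span_sum span_scale span_base)
  have orth: "(d - ?p) \<bullet> e = 0" if "e \<in> F" for e
    using orthonormal_inner_sum[OF assms subset_refl that] by (simp add: inner_diff_left)
  show ?thesis
  proof (cases "d = ?p")
    case True
    then show ?thesis using assms p by (metis subset_refl)
  next
    case False
    define u where "u = sgn (d - ?p)"
    have "norm u = 1" using False by (simp add: u_def norm_sgn)
    moreover have "orthogonal u e" if "e \<in> F" for e
      using orth[OF that] by (simp add: u_def sgn_div_norm orthogonal_def)
    ultimately have "orthonormal (insert u F)"
      using assms by (auto simp: orthonormal_def pairwise_insert orthogonal_commute)
    moreover have "d \<in> span (insert u F)"
    proof -
      have "d = norm (d - ?p) *\<^sub>R u + ?p" using False by (simp add: u_def sgn_div_norm)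
      moreover have "norm (d - ?p) *\<^sub>R u \<in> span (insert u F)"
        by (intro span_scale span_base) simp
      moreover have "?p \<in> span (insert u F)"
        using p span_mono[of F "insert u F"] by blast
      ultimately show ?thesis by (metis span_add)
    qed
    ultimately show ?thesis using assms(2) by (metis finite_insert subset_insertI)
  qed
qed

lemma onb_exists: "\<exists>B::'a::{real_inner,second_countable_topology} set. onb B \<and> countable B"
proof -
  obtain D :: "'a set" where D: "countable D" "\<And>X. open X \<Longrightarrow> X \<noteq> {} \<Longrightarrow> \<exists>d\<in>D. d \<in> X"
    using countable_dense_exists by blast
  have Dne: "D \<noteq> {}" using D(2)[of UNIV] by auto
  define d where "d = from_nat_into D"
  have d: "range d = D" using D(1) Dne by (simp add: d_def range_from_nat_into)
  have "\<exists>G. \<forall>n. (orthonormal (G n) \<and> finite (G n)) \<and> (G n \<subseteq> G (Suc n) \<and> d n \<in> span (G (Suc n)))"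
  proof (rule dependent_nat_choice)
    show "\<exists>x::'a set. orthonormal x \<and> finite x" by (rule exI[of _ "{}"]) (simp add: orthonormal_def)
  next
    fix F :: "'a set" and n
    assume "orthonormal F \<and> finite F"
    then show "\<exists>y. (orthonormal y \<and> finite y) \<and> F \<subseteq> y \<and> d n \<in> span y"
      using orthonormal_extend by blast
  qed
  then obtain G where G: "\<And>n. orthonormal (G n)" "\<And>n. finite (G n)" "\<And>n. G n \<subseteq> G (Suc n)"
    "\<And>n. d n \<in> span (G (Suc n))" by blast
  have mono: "G m \<subseteq> G n" if "m \<le> n" for m n using that G(3) by (rule lift_Suc_mono_le[rotated])
  define B where "B = (\<Union>n. G n)"
  have "orthonormal B"
    unfolding orthonormal_def
  proof
    show "\<forall>e\<in>B. norm e = 1" using G(1) by (auto simp: B_def orthonormal_def)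
    show "pairwise orthogonal B"
      unfolding pairwise_def
    proof (intro ballI impI)
      fix x y assume "x \<in> B" "y \<in> B" and ne: "x \<noteq> y"
      then obtain m n where "x \<in> G m" "y \<in> G n" by (auto simp: B_def)
      then have "x \<in> G (max m n)" "y \<in> G (max m n)"
        using mono[of m "max m n"] mono[of n "max m n"] by auto
      then show "orthogonal x y" using G(1)[of "max m n"] ne by (auto simp: orthonormal_def pairwise_def)
    qed
  qed
  moreover have "closure (span B) = UNIV"
  proof -
    have "D \<subseteq> span B"
    proof
      fix x assume "x \<in> D"
      then obtain n where "x = d n" using d by auto
      then show "x \<in> span B" using G(4)[of n] span_mono[of "G (Suc n)" B] by (auto simp: B_def)
    qed
    moreover have "closure D = UNIV"
    proof -
      have "x \<in> closure D" for x
        unfolding closure_approachable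
      proof (intro allI impI)
        fix e :: real assume "e > 0"
        then show "\<exists>y\<in>D. dist y x < e" using D(2)[of "ball x e"] by (auto simp: dist_commute)
      qed
      then show ?thesis by auto
    qed
    ultimately show ?thesis using closure_mono[of D "span B"] by auto
  qed
  moreover have "countable B" using G(2) by (auto simp: B_def countable_finite)
  ultimately show ?thesis by (auto simp: onb_def)
qed

definition some_onb :: "'a::{real_inner,second_countable_topology} set" where
  "some_onb = (SOME B. onb B \<and> countable B)"

lemma onb_some_onb: "onb (some_onb :: 'a::{real_inner,second_countable_topology} set)"
  and countable_some_onb: "countable (some_onb :: 'a set)"
  using someI_ex[OF onb_exists] by (auto simp: some_onb_def)


section \<open>Hilbert-Schmidt operators\<close>

text \<open>As usual, the definition refers to one orthonormal basis; \<open>hs_sum_basis_indep\<close> below shows that the choice is immaterial.\<close>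

definition hilbert_schmidt :: "'a::real_inner \<Rightarrow>\<^sub>L 'b::real_inner \<Rightarrow> bool" where
  "hilbert_schmidt T \<longleftrightarrow> (\<exists>B. onb B \<and> (\<lambda>e. (norm (T e))\<^sup>2) summable_on B)"

lemma onb_functional:
  fixes \<phi> :: "'a::real_inner \<Rightarrow> real"
  assumes "onb B" and \<phi>: "bounded_linear \<phi>"
  shows "((\<lambda>e. (\<phi> e)\<^sup>2) has_sum (onorm \<phi>)\<^sup>2) B"
proof -
  interpret bounded_linear \<phi> by fact
  have B: "orthonormal B" using assms by (simp add: onb_def)
  have le: "(\<Sum>e\<in>F. (\<phi> e)\<^sup>2) \<le> (onorm \<phi>)\<^sup>2" if F: "finite F" "F \<subseteq> B" for F
  proof -
    let ?s = "\<Sum>e\<in>F. (\<phi> e)\<^sup>2" and ?v = "\<Sum>e\<in>F. \<phi> e *\<^sub>R e"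
    have s0: "?s \<ge> 0" by (simp add: sum_nonneg)
    have "\<phi> ?v = ?s" by (simp add: sum scaleR power2_eq_square)
    then have "?s \<le> onorm \<phi> * norm ?v" using onorm[OF \<phi>, of ?v] by simp
    then have "?s\<^sup>2 \<le> (onorm \<phi> * norm ?v)\<^sup>2" using s0 by (rule power_mono)
    also have "\<dots> = (onorm \<phi>)\<^sup>2 * ?s"
      using orthonormal_norm_sum[OF B F] by (simp add: power_mult_distrib)
    finally have "?s * ?s \<le> (onorm \<phi>)\<^sup>2 * ?s" by (simp add: power2_eq_square)
    then show ?thesis using s0 by (cases "?s = 0") (simp_all add: mult_le_cancel_right)
  qed
  have summ: "(\<lambda>e. (\<phi> e)\<^sup>2) summable_on B"
    by (rule nonneg_bdd_above_summable_on) (use le in \<open>auto intro!: bdd_aboveI2\<close>)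
  let ?S = "\<Sum>\<^sub>\<infinity>e\<in>B. (\<phi> e)\<^sup>2"
  have "?S \<le> (onorm \<phi>)\<^sup>2"
    by (rule infsum_le_finite_sums[OF summ le])
  moreover have "(onorm \<phi>)\<^sup>2 \<le> ?S"
  proof -
    have S0: "?S \<ge> 0" by (rule infsum_nonneg) simp
    have "norm (\<phi> x) \<le> sqrt ?S * norm x" for x
    proof -
      have "((\<lambda>e. \<phi> ((x \<bullet> e) *\<^sub>R e)) has_sum \<phi> x) B"
        by (rule has_sum_bounded_linear[OF \<phi> onb_expansion[OF assms(1)]])
      then have hs: "((\<lambda>e. (x \<bullet> e) * \<phi> e) has_sum \<phi> x) B" by (simp add: scaleR)
      have "norm (\<Sum>e\<in>F. (x \<bullet> e) * \<phi> e) \<le> sqrt ?S * norm x" if F: "finite F" "F \<subseteq> B" for F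
      proof -
        have "norm (\<Sum>e\<in>F. (x \<bullet> e) * \<phi> e) \<le> (\<Sum>e\<in>F. \<bar>x \<bullet> e\<bar> * \<bar>\<phi> e\<bar>)"
          by (rule order_trans[OF norm_sum]) (simp add: abs_mult)
        also have "\<dots> \<le> L2_set (\<lambda>e. x \<bullet> e) F * L2_set \<phi> F" by (rule L2_set_mult_ineq)
        also have "\<dots> \<le> norm x * sqrt ?S"
        proof (intro mult_mono)
          have "(\<Sum>e\<in>F. (x \<bullet> e)\<^sup>2) \<le> (norm x)\<^sup>2"
            by (rule finite_sum_le_has_sum[OF onb_parseval[OF assms(1)] F(1,2)]) auto
          then show "L2_set (\<lambda>e. x \<bullet> e) F \<le> norm x" by (simp add: L2_set_def real_le_lsqrt)
          have "(\<Sum>e\<in>F. (\<phi> e)\<^sup>2) \<le> ?S"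
            by (rule finite_sum_le_infsum[OF summ F]) auto
          then show "L2_set \<phi> F \<le> sqrt ?S" by (simp add: L2_set_def)
        qed (auto simp: L2_set_nonneg)
        finally show ?thesis by (simp add: mult.commute)
      qed
      then have "\<forall>\<^sub>F F in finite_subsets_at_top B. norm (\<Sum>e\<in>F. (x \<bullet> e) * \<phi> e) \<le> sqrt ?S * norm x"
        by (auto simp: eventually_finite_subsets_at_top)
      then show ?thesis
        using tendsto_upperbound[OF tendsto_norm[OF hs[unfolded has_sum_def]]] by fastforce
    qed
    then have "onorm \<phi> \<le> sqrt ?S" using S0 by (intro onorm_bound) auto
    then have "(onorm \<phi>)\<^sup>2 \<le> (sqrt ?S)\<^sup>2" by (intro power_mono onorm_pos_le[OF \<phi>])
    then show ?thesis using S0 by simp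
  qed
  ultimately show ?thesis using summ by (metis antisym has_sum_infsum)
qed

lemma has_sum_swap_nonneg:
  fixes g :: "'a \<times> 'b \<Rightarrow> real"
  assumes nn: "\<And>z. g z \<ge> 0"
    and a: "\<And>x. x \<in> A \<Longrightarrow> ((\<lambda>y. g (x, y)) has_sum a x) B"
    and b: "\<And>y. y \<in> B \<Longrightarrow> ((\<lambda>x. g (x, y)) has_sum b y) A"
    and S: "(a has_sum S) A"
  shows "(b has_sum S) B"
proof -
  have "g summable_on (A \<times> B)"
    by (rule summable_on_SigmaI[OF a]) (use S nn in \<open>auto simp: summable_on_def\<close>)
  then have "(g has_sum S) (A \<times> B)" using has_sum_SigmaI[OF a S] by blast
  then have "((\<lambda>(x,y). g (y,x)) has_sum S) (B \<times> A)" by (rule has_sum_swap[THEN iffD1])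
  then show ?thesis by (rule has_sum_SigmaD) (use b in auto)
qed

lemma hs_sum_basis_indep:
  fixes T :: "'a::real_inner \<Rightarrow>\<^sub>L 'b::{real_inner,second_countable_topology}"
  assumes B: "onb B" and B': "onb B'"
    and S: "((\<lambda>e. (norm (T e))\<^sup>2) has_sum S) B"
  shows "((\<lambda>e. (norm (T e))\<^sup>2) has_sum S) B'"
proof -
  obtain C :: "'b set" where C: "onb C" using onb_exists by blast
  define g where "g = (\<lambda>(e, f). (T e \<bullet> f)\<^sup>2)"
  define b where "b = (\<lambda>f. (onorm (\<lambda>x. T x \<bullet> f))\<^sup>2)"
  have bl: "bounded_linear (\<lambda>x. T x \<bullet> f)" for f
    by (intro bounded_linear_inner_left_comp blinfun.bounded_linear_right)
  have 1: "((\<lambda>f. g (e, f)) has_sum (norm (T e))\<^sup>2) C" for e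
    unfolding g_def using onb_parseval[OF C] by simp
  have 2: "((\<lambda>e. g (e, f)) has_sum b f) B" "((\<lambda>e. g (e, f)) has_sum b f) B'" for f
    unfolding g_def b_def using onb_functional[OF _ bl] B B' by simp_all
  have "(b has_sum S) C"
    by (rule has_sum_swap_nonneg[where g = g, OF _ 1 2(1) S]) (simp add: g_def split: prod.split)
  then show ?thesis
    by (rule has_sum_swap_nonneg[where g = "\<lambda>(f, e). g (e, f)" and a = b and A = C, rotated -1])
      (auto simp: g_def 1[unfolded g_def case_prod_conv] 2[unfolded g_def case_prod_conv])
qed

lemma hilbert_schmidt_iff:
  fixes T :: "'a::real_inner \<Rightarrow>\<^sub>L 'b::{real_inner,second_countable_topology}"
  assumes "onb B"
  shows "hilbert_schmidt T \<longleftrightarrow> (\<lambda>e. (norm (T e))\<^sup>2) summable_on B"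
  using assms hs_sum_basis_indep unfolding hilbert_schmidt_def summable_on_def by metis

lemma hilbert_schmidt_inner_summable:
  fixes S T :: "'a::real_inner \<Rightarrow>\<^sub>L 'b::{real_inner,second_countable_topology}"
  assumes "onb B" "hilbert_schmidt S" "hilbert_schmidt T"
  shows "(\<lambda>e. S e \<bullet> T e) summable_on B"
proof -
  have "(\<lambda>e. (norm (S e))\<^sup>2 + (norm (T e))\<^sup>2) summable_on B"
    using assms by (intro summable_on_add) (auto simp: hilbert_schmidt_iff)
  then have "(\<lambda>e. norm (S e \<bullet> T e)) summable_on B"
  proof (rule summable_on_comparison_test)
    fix e
    have "\<bar>S e \<bullet> T e\<bar> \<le> norm (S e) * norm (T e)" by (rule Cauchy_Schwarz_ineq2)
    also have "\<dots> \<le> (norm (S e))\<^sup>2 + (norm (T e))\<^sup>2"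
    proof -
      have "2 * (norm (S e) * norm (T e)) \<le> (norm (S e))\<^sup>2 + (norm (T e))\<^sup>2"
        using sum_squares_bound[of "norm (S e)" "norm (T e)"] by simp
      moreover have "0 \<le> norm (S e) * norm (T e)" by simp
      ultimately show ?thesis by linarith
    qed
    finally show "norm (S e \<bullet> T e) \<le> (norm (S e))\<^sup>2 + (norm (T e))\<^sup>2" by simp
  qed simp
  then show ?thesis by (rule abs_summable_summable)
qed

lemma hilbert_schmidt_add:
  fixes S T :: "'a::real_inner \<Rightarrow>\<^sub>L 'b::{real_inner,second_countable_topology}"
  assumes "hilbert_schmidt S" "hilbert_schmidt T"
  shows "hilbert_schmidt (S + T)"
proof -
  obtain B :: "'a set" where B: "onb B" using assms(1) unfolding hilbert_schmidt_def by blast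
  have "(\<lambda>e. (norm (S e))\<^sup>2 + (norm (T e))\<^sup>2 + 2 * (S e \<bullet> T e)) summable_on B"
    using assms B hilbert_schmidt_inner_summable[OF B assms]
    by (intro summable_on_add summable_on_cmult_right) (auto simp: hilbert_schmidt_iff[OF B])
  moreover have "(norm ((S + T) e))\<^sup>2 = (norm (S e))\<^sup>2 + (norm (T e))\<^sup>2 + 2 * (S e \<bullet> T e)" for e
    by (simp add: power2_norm_eq_inner blinfun.add_left algebra_simps inner_commute)
  ultimately show ?thesis by (simp add: hilbert_schmidt_iff[OF B])
qed

lemma hilbert_schmidt_scaleR:
  "hilbert_schmidt T \<Longrightarrow> hilbert_schmidt (r *\<^sub>R T)"
  unfolding hilbert_schmidt_def
  by (auto simp: blinfun.scaleR_left power_mult_distrib intro!: summable_on_cmult_right)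

lemma hilbert_schmidt_0:
  "hilbert_schmidt (0 :: 'a::{real_inner,second_countable_topology} \<Rightarrow>\<^sub>L 'b::real_inner)"
  unfolding hilbert_schmidt_def using onb_exists by auto

typedef (overloaded) 'a hs =
  "{T :: 'a::{real_inner,banach,second_countable_topology} \<Rightarrow>\<^sub>L 'a. hilbert_schmidt T}"
  morphisms hs_op Abs_hs
  using hilbert_schmidt_0 by auto

setup_lifting type_definition_hs

lemma hilbert_schmidt_hs_op [simp]: "hilbert_schmidt (hs_op T)"
  using hs_op by auto

instantiation hs :: ("{real_inner,banach,second_countable_topology}") real_inner
begin

lift_definition zero_hs :: "'a hs" is 0 by (rule hilbert_schmidt_0)

lift_definition plus_hs :: "'a hs \<Rightarrow> 'a hs \<Rightarrow> 'a hs" is "(+)" by (rule hilbert_schmidt_add)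

lift_definition scaleR_hs :: "real \<Rightarrow> 'a hs \<Rightarrow> 'a hs" is "scaleR" by (rule hilbert_schmidt_scaleR)

lift_definition uminus_hs :: "'a hs \<Rightarrow> 'a hs" is uminus
  by (metis hilbert_schmidt_scaleR scaleR_minus1_left)

lift_definition minus_hs :: "'a hs \<Rightarrow> 'a hs \<Rightarrow> 'a hs" is "(-)"
  by (metis hilbert_schmidt_scaleR hilbert_schmidt_add scaleR_minus1_left uminus_add_conv_diff add.commute)

definition inner_hs :: "'a hs \<Rightarrow> 'a hs \<Rightarrow> real" where
  "inner_hs S T = (\<Sum>\<^sub>\<infinity>e\<in>some_onb. hs_op S e \<bullet> hs_op T e)"

definition norm_hs :: "'a hs \<Rightarrow> real" where "norm_hs T = sqrt (T \<bullet> T)"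
definition dist_hs :: "'a hs \<Rightarrow> 'a hs \<Rightarrow> real" where "dist_hs S T = norm (S - T)"
definition sgn_hs :: "'a hs \<Rightarrow> 'a hs" where "sgn_hs T = scaleR (inverse (norm T)) T"
definition uniformity_hs :: "('a hs \<times> 'a hs) filter" where
  "uniformity_hs = (INF e\<in>{0<..}. principal {(x, y). dist x y < e})"
definition open_hs :: "'a hs set \<Rightarrow> bool" where
  "open_hs U \<longleftrightarrow> (\<forall>x\<in>U. \<forall>\<^sub>F (x', y) in uniformity. x' = x \<longrightarrow> y \<in> U)"

instance
proof
  fix x y z :: "'a hs" and r s :: real and U :: "'a hs set"
  note summ = hilbert_schmidt_inner_summable[OF onb_some_onb hilbert_schmidt_hs_op hilbert_schmidt_hs_op]
  show "x + y + z = x + (y + z)" "x + y = y + x" "0 + x = x" "- x + x = 0" "x - y = x + - y"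
    "r *\<^sub>R (x + y) = r *\<^sub>R x + r *\<^sub>R y" "(r + s) *\<^sub>R x = r *\<^sub>R x + s *\<^sub>R x"
    "r *\<^sub>R s *\<^sub>R x = (r * s) *\<^sub>R x" "1 *\<^sub>R x = x"
    by (transfer; simp add: algebra_simps)+
  show "dist x y = norm (x - y)" "sgn x = scaleR (inverse (norm x)) x" "norm x = sqrt (x \<bullet> x)"
    "uniformity = (INF e\<in>{0<..}. principal {(x :: 'a hs, y). dist x y < e})"
    "open U \<longleftrightarrow> (\<forall>x\<in>U. \<forall>\<^sub>F (x', y) in uniformity. x' = x \<longrightarrow> y \<in> U)"
    by (simp_all add: dist_hs_def sgn_hs_def norm_hs_def uniformity_hs_def open_hs_def)
  show "x \<bullet> y = y \<bullet> x" by (simp add: inner_hs_def inner_commute)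
  show "(x + y) \<bullet> z = x \<bullet> z + y \<bullet> z"
    by (simp add: inner_hs_def plus_hs.rep_eq blinfun.add_left inner_add_left infsum_add summ)
  show "(r *\<^sub>R x) \<bullet> y = r * (x \<bullet> y)"
    by (simp add: inner_hs_def scaleR_hs.rep_eq blinfun.scaleR_left infsum_cmult_right')
  show "0 \<le> x \<bullet> x" by (simp add: inner_hs_def infsum_nonneg)
  show "x \<bullet> x = 0 \<longleftrightarrow> x = 0"
  proof
    assume "x = 0"
    then show "x \<bullet> x = 0" by (simp add: inner_hs_def zero_hs.rep_eq)
  next
    assume "x \<bullet> x = 0"
    then have z: "hs_op x e = 0" if "e \<in> some_onb" for e
    proof -
      have "hs_op x e \<bullet> hs_op x e = 0"
        by (rule nonneg_infsum_le_0D[OF _ summ _ that])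
          (use \<open>x \<bullet> x = 0\<close> in \<open>simp_all add: inner_hs_def\<close>)
      then show ?thesis by simp
    qed
    have "hs_op x v = 0" for v
    proof -
      have "((\<lambda>e. hs_op x ((v \<bullet> e) *\<^sub>R e)) has_sum hs_op x v) some_onb"
        by (rule has_sum_bounded_linear[OF blinfun.bounded_linear_right onb_expansion[OF onb_some_onb]])
      moreover have "((\<lambda>e. hs_op x ((v \<bullet> e) *\<^sub>R e)) has_sum 0) some_onb"
        by (rule has_sum_0) (simp add: blinfun.scaleR_right z)
      ultimately show ?thesis by (rule has_sum_unique)
    qed
    then show "x = 0" by (metis blinfun_eqI hs_op_inject zero_hs.rep_eq zero_blinfun.rep_eq)
  qed
qed

end

lemma hs_inner_has_sum:
  assumes "onb B"
  shows "((\<lambda>e. hs_op S e \<bullet> hs_op T e) has_sum (S \<bullet> T)) B"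
proof -
  have *: "((\<lambda>e. (norm (hs_op R e))\<^sup>2) has_sum (R \<bullet> R)) B" for R :: "'a hs"
    using hilbert_schmidt_inner_summable[OF onb_some_onb hilbert_schmidt_hs_op hilbert_schmidt_hs_op, of R R]
    by (intro hs_sum_basis_indep[OF onb_some_onb assms])
      (simp add: inner_hs_def power2_norm_eq_inner)
  have "((\<lambda>e. ((norm (hs_op (S + T) e))\<^sup>2 + (- ((norm (hs_op S e))\<^sup>2) + - ((norm (hs_op T e))\<^sup>2))) * (1/2))
      has_sum (((S + T) \<bullet> (S + T) + (- (S \<bullet> S) + - (T \<bullet> T))) * (1/2))) B"
    by (intro has_sum_cmult_left has_sum_add has_sum_uminusI *)
  moreover have "((S + T) \<bullet> (S + T) + (- (S \<bullet> S) + - (T \<bullet> T))) * (1/2) = S \<bullet> T"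
    by (simp add: algebra_simps inner_commute)
  moreover have "((norm (hs_op (S + T) e))\<^sup>2 + (- ((norm (hs_op S e))\<^sup>2) + - ((norm (hs_op T e))\<^sup>2))) * (1/2)
     = hs_op S e \<bullet> hs_op T e" for e
    by (simp add: power2_norm_eq_inner plus_hs.rep_eq blinfun.add_left algebra_simps inner_commute)
  ultimately show ?thesis by simp
qed

lemma hs_norm_has_sum:
  assumes "onb B"
  shows "((\<lambda>e. (norm (hs_op T e))\<^sup>2) has_sum (norm T)\<^sup>2) B"
  using hs_inner_has_sum[OF assms, of T T] by (simp add: power2_norm_eq_inner)

lemma hs_op_norm_le: "norm (hs_op T) \<le> norm T"
proof (rule norm_blinfun_bound)
  fix x :: 'a
  let ?B = "some_onb :: 'a set"
  have hs: "((\<lambda>e. (x \<bullet> e) *\<^sub>R hs_op T e) has_sum hs_op T x) ?B"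
    using has_sum_bounded_linear[OF blinfun.bounded_linear_right onb_expansion[OF onb_some_onb]]
    by (simp add: blinfun.scaleR_right)
  have "norm (\<Sum>e\<in>F. (x \<bullet> e) *\<^sub>R hs_op T e) \<le> norm T * norm x" if F: "finite F" "F \<subseteq> ?B" for F
  proof -
    have "norm (\<Sum>e\<in>F. (x \<bullet> e) *\<^sub>R hs_op T e) \<le> (\<Sum>e\<in>F. \<bar>x \<bullet> e\<bar> * \<bar>norm (hs_op T e)\<bar>)"
      by (rule order_trans[OF norm_sum]) simp
    also have "\<dots> \<le> L2_set (\<lambda>e. x \<bullet> e) F * L2_set (\<lambda>e. norm (hs_op T e)) F"
      by (rule L2_set_mult_ineq)
    also have "\<dots> \<le> norm x * norm T"
    proof (intro mult_mono)
      have "(\<Sum>e\<in>F. (x \<bullet> e)\<^sup>2) \<le> (norm x)\<^sup>2"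
        by (rule finite_sum_le_has_sum[OF onb_parseval[OF onb_some_onb] F(1,2)]) auto
      then show "L2_set (\<lambda>e. x \<bullet> e) F \<le> norm x" by (simp add: L2_set_def real_le_lsqrt)
      have "(\<Sum>e\<in>F. (norm (hs_op T e))\<^sup>2) \<le> (norm T)\<^sup>2"
        by (rule finite_sum_le_has_sum[OF hs_norm_has_sum[OF onb_some_onb] F(1,2)]) auto
      then show "L2_set (\<lambda>e. norm (hs_op T e)) F \<le> norm T" by (simp add: L2_set_def real_le_lsqrt)
    qed (auto simp: L2_set_nonneg)
    finally show ?thesis by (simp add: mult.commute)
  qed
  then have "\<forall>\<^sub>F F in finite_subsets_at_top ?B. norm (\<Sum>e\<in>F. (x \<bullet> e) *\<^sub>R hs_op T e) \<le> norm T * norm x"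
    by (auto simp: eventually_finite_subsets_at_top)
  then show "norm (hs_op T x) \<le> norm T * norm x"
    using tendsto_upperbound[OF tendsto_norm[OF hs[unfolded has_sum_def]]] by fastforce
qed simp

lemma hilbert_schmidt_boundI:
  fixes T :: "'a::{real_inner,banach,second_countable_topology} \<Rightarrow>\<^sub>L 'a"
  assumes c: "c \<ge> 0" and le: "\<And>F. finite F \<Longrightarrow> F \<subseteq> some_onb \<Longrightarrow> (\<Sum>e\<in>F. (norm (T e))\<^sup>2) \<le> c\<^sup>2"
  shows "hilbert_schmidt T" "norm (Abs_hs T) \<le> c"
proof -
  show hs: "hilbert_schmidt T"
    unfolding hilbert_schmidt_iff[OF onb_some_onb]
    by (rule nonneg_bdd_above_summable_on) (use le in \<open>auto intro!: bdd_aboveI2\<close>)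
  have "((\<lambda>e. (norm (T e))\<^sup>2) has_sum (norm (Abs_hs T))\<^sup>2) some_onb"
    using hs_norm_has_sum[OF onb_some_onb, of "Abs_hs T"] hs by (simp add: Abs_hs_inverse)
  then have "(norm (Abs_hs T))\<^sup>2 \<le> c\<^sup>2"
    by (rule has_sum_le_finite_sums) (use le in auto)
  then show "norm (Abs_hs T) \<le> c" using c by (rule power2_le_imp_le)
qed

instance hs :: ("{real_inner,banach,second_countable_topology}") banach
proof
  fix X :: "nat \<Rightarrow> 'a hs"
  assume X: "Cauchy X"
  have "Cauchy (\<lambda>n. hs_op (X n))"
  proof (rule CauchyI)
    fix e :: real assume "e > 0"
    then obtain N where N: "\<And>m n. m \<ge> N \<Longrightarrow> n \<ge> N \<Longrightarrow> norm (X m - X n) < e"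
      using CauchyD[OF X] by blast
    have "norm (hs_op (X m) - hs_op (X n)) < e" if "m \<ge> N" "n \<ge> N" for m n
      using N[OF that] hs_op_norm_le[of "X m - X n"] by (simp add: minus_hs.rep_eq)
    then show "\<exists>M. \<forall>m\<ge>M. \<forall>n\<ge>M. norm (hs_op (X m) - hs_op (X n)) < e" by blast
  qed
  then obtain A where A: "(\<lambda>n. hs_op (X n)) \<longlonglongrightarrow> A"
    by (auto simp: Cauchy_convergent_iff convergent_def)
  have key: "\<exists>N. \<forall>n\<ge>N. hilbert_schmidt (hs_op (X n) - A) \<and> norm (Abs_hs (hs_op (X n) - A)) \<le> e"
    if "e > 0" for e :: real
  proof -
    obtain N where N: "\<And>m n. m \<ge> N \<Longrightarrow> n \<ge> N \<Longrightarrow> norm (X m - X n) < e"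
      using CauchyD[OF X \<open>e > 0\<close>] by blast
    have *: "(\<Sum>v\<in>F. (norm ((hs_op (X n) - A) v))\<^sup>2) \<le> e\<^sup>2"
      if n: "n \<ge> N" and F: "finite F" "F \<subseteq> some_onb" for n F
    proof (rule tendsto_upperbound)
      show "(\<lambda>m. \<Sum>v\<in>F. (norm ((hs_op (X n) - hs_op (X m)) v))\<^sup>2) \<longlonglongrightarrow>
        (\<Sum>v\<in>F. (norm ((hs_op (X n) - A) v))\<^sup>2)"
        by (intro tendsto_intros A)
      have "(\<Sum>v\<in>F. (norm ((hs_op (X n) - hs_op (X m)) v))\<^sup>2) \<le> e\<^sup>2" if m: "m \<ge> N" for m
      proof -
        have "(\<Sum>v\<in>F. (norm (hs_op (X n - X m) v))\<^sup>2) \<le> (norm (X n - X m))\<^sup>2"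
          by (rule finite_sum_le_has_sum[OF hs_norm_has_sum[OF onb_some_onb] F(1,2)]) auto
        also have "\<dots> \<le> e\<^sup>2" using N[OF n m] by (intro power_mono) auto
        finally show ?thesis by (simp add: minus_hs.rep_eq)
      qed
      then show "\<forall>\<^sub>F m in sequentially. (\<Sum>v\<in>F. (norm ((hs_op (X n) - hs_op (X m)) v))\<^sup>2) \<le> e\<^sup>2"
        by (auto simp: eventually_sequentially)
    qed simp
    have e0: "e \<ge> 0" using \<open>e > 0\<close> by simp
    show ?thesis
      using hilbert_schmidt_boundI[OF e0 *] by blast
  qed
  obtain N where "hilbert_schmidt (hs_op (X N) - A)" using key[of 1] by auto
  then have "hilbert_schmidt (hs_op (X N) + (-1) *\<^sub>R (hs_op (X N) - A))"
    by (intro hilbert_schmidt_add hilbert_schmidt_scaleR hilbert_schmidt_hs_op)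
  then have "hilbert_schmidt A" by simp
  then have eq: "Abs_hs (hs_op (X n) - A) = X n - Abs_hs A" for n
    by (metis Abs_hs_inverse hs_op_inverse mem_Collect_eq minus_hs.rep_eq)
  have "X \<longlonglongrightarrow> Abs_hs A"
  proof (rule LIMSEQ_I)
    fix r :: real assume "r > 0"
    then obtain N where "\<forall>n\<ge>N. norm (X n - Abs_hs A) \<le> r / 2"
      using key[of "r / 2"] by (auto simp: eq)
    then show "\<exists>N. \<forall>n\<ge>N. norm (X n - Abs_hs A) < r"
      using \<open>r > 0\<close> by (metis (no_types, opaque_lifting) field_sum_of_halves le_less_trans less_add_same_cancel1 half_gt_zero)
  qed
  then show "convergent X" by (auto simp: convergent_def)
qed

lemma second_countable_if_countable_dense:
  fixes D :: "'a::metric_space set"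
  assumes D: "countable D" and dense: "\<And>x e. e > 0 \<Longrightarrow> \<exists>d\<in>D. dist d x < e"
  shows "\<exists>B::'a set set. countable B \<and> open = generate_topology B"
proof -
  let ?B = "(\<lambda>(d, n). ball d (1 / real (Suc n))) ` (D \<times> (UNIV::nat set))"
  have "topological_basis ?B"
  proof (rule topological_basisI)
    fix U :: "'a set" and x assume "open U" "x \<in> U"
    then obtain e where e: "e > 0" "ball x e \<subseteq> U" by (meson open_contains_ball)
    obtain n where n: "1 / real (Suc n) < e / 2"
      using reals_Archimedean[of "e / 2"] e by (auto simp: inverse_eq_divide)
    obtain d where d: "d \<in> D" "dist d x < 1 / real (Suc n)" using dense[of "1 / real (Suc n)" x] by auto
    have "ball d (1 / real (Suc n)) \<subseteq> U"
    proof
      fix y assume "y \<in> ball d (1 / real (Suc n))"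
      then have "dist x y < e"
        using d n dist_triangle[of x y d] by (simp add: dist_commute)
      then show "y \<in> U" using e by auto
    qed
    then show "\<exists>B'\<in>?B. x \<in> B' \<and> B' \<subseteq> U" using d by (intro bexI[of _ "ball d (1 / real (Suc n))"]) auto
  qed auto
  moreover have "countable ?B" using D by (intro countable_image countable_SIGMA) auto
  ultimately show ?thesis using topological_basis_imp_subbasis by blast
qed

instance hs :: ("{real_inner,banach,second_countable_topology}") second_countable_topology
proof
  let ?B = "some_onb :: 'a set"
  obtain D0 :: "'a set" where D0: "countable D0" "\<And>X. open X \<Longrightarrow> X \<noteq> {} \<Longrightarrow> \<exists>d\<in>D0. d \<in> X"
    using countable_dense_exists by blast
  have B: "orthonormal ?B" using onb_some_onb[unfolded onb_def] by blast
  define R where "R = (\<lambda>(e :: 'a) (d :: 'a). blinfun_scaleR_left d o\<^sub>L blinfun_inner_left e)"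
  have R: "R e d x = (x \<bullet> e) *\<^sub>R d" for e d x by (simp add: R_def)
  define op where "op = (\<lambda>l. Abs_hs (\<Sum>(e, d)\<leftarrow>l. R e d))"
  define D where "D = op ` lists (?B \<times> D0)"
  have "countable D"
    unfolding D_def using countable_some_onb D0(1) by (intro countable_image countable_lists countable_SIGMA) auto
  moreover have "\<exists>d\<in>D. dist d T < \<epsilon>" if "\<epsilon> > 0" for T :: "'a hs" and \<epsilon> :: real
  proof -
    note sumT = hs_norm_has_sum[OF onb_some_onb, of T]
    obtain F where F: "finite F" "F \<subseteq> ?B" "dist (\<Sum>e\<in>F. (norm (hs_op T e))\<^sup>2) ((norm T)\<^sup>2) \<le> \<epsilon>\<^sup>2 / 8"
      using has_sum_finite_approximation[OF sumT, of "\<epsilon>\<^sup>2 / 8"] \<open>\<epsilon> > 0\<close> by auto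
    define \<delta> where "\<delta> = \<epsilon>\<^sup>2 / 8 / (real (card F) + 1)"
    have \<delta>: "\<delta> > 0" using \<open>\<epsilon> > 0\<close> by (simp add: \<delta>_def)
    have "\<exists>d\<in>D0. norm (d - hs_op T e) < sqrt \<delta>" for e
      using D0(2)[of "ball (hs_op T e) (sqrt \<delta>)"] \<delta> by (auto simp: dist_norm norm_minus_commute)
    then obtain d where d: "\<And>e. d e \<in> D0" "\<And>e. norm (d e - hs_op T e) < sqrt \<delta>" by metis
    obtain l where l: "set l = F" "distinct l" using F(1) finite_distinct_list by blast
    define L where "L = map (\<lambda>e. (e, d e)) l"
    have "L \<in> lists (?B \<times> D0)" using F l d by (auto simp: L_def)
    define A where "A = (\<Sum>e\<in>F. R e (d e))"
    have AL: "(\<Sum>(e, d)\<leftarrow>L. R e d) = A"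
      unfolding L_def A_def using l by (simp add: comp_def sum_list_distinct_conv_sum_set)
    have A_in: "A v = d v" if "v \<in> F" for v
    proof -
      have "A v = (\<Sum>e\<in>F. (v \<bullet> e) *\<^sub>R d e)" by (simp add: A_def blinfun.sum_left R)
      also have "\<dots> = (\<Sum>e\<in>F. if e = v then d e else 0)"
        by (rule sum.cong) (use F(2) that in \<open>auto simp: orthonormal_inner[OF B] subset_iff\<close>)
      finally show ?thesis using F that by simp
    qed
    have A_out: "A v = 0" if "v \<in> ?B" "v \<notin> F" for v
    proof -
      have "A v = (\<Sum>e\<in>F. (v \<bullet> e) *\<^sub>R d e)" by (simp add: A_def blinfun.sum_left R)
      also have "\<dots> = 0"
        by (rule sum.neutral) (use F(2) that in \<open>auto simp: orthonormal_inner[OF B] subset_iff\<close>)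
      finally show ?thesis .
    qed
    have bnd: "(\<Sum>v\<in>G. (norm ((A - hs_op T) v))\<^sup>2) \<le> (\<epsilon> / 2)\<^sup>2" if G: "finite G" "G \<subseteq> ?B" for G
    proof -
      have "(\<Sum>v\<in>G. (norm ((A - hs_op T) v))\<^sup>2)
        = (\<Sum>v\<in>G \<inter> F. (norm ((A - hs_op T) v))\<^sup>2) + (\<Sum>v\<in>G - F. (norm ((A - hs_op T) v))\<^sup>2)"
        using G by (metis sum.Int_Diff)
      also have "(\<Sum>v\<in>G - F. (norm ((A - hs_op T) v))\<^sup>2) = (\<Sum>v\<in>G - F. (norm (hs_op T v))\<^sup>2)"
        by (rule sum.cong) (use A_out G in \<open>auto simp: blinfun.diff_left\<close>)
      also have "\<dots> \<le> \<epsilon>\<^sup>2 / 8"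
      proof -
        have "(\<Sum>v\<in>(G - F) \<union> F. (norm (hs_op T v))\<^sup>2) \<le> (norm T)\<^sup>2"
          by (rule finite_sum_le_has_sum[OF sumT]) (use F G in auto)
        then have "(\<Sum>v\<in>G - F. (norm (hs_op T v))\<^sup>2) + (\<Sum>v\<in>F. (norm (hs_op T v))\<^sup>2) \<le> (norm T)\<^sup>2"
          using F G by (subst (asm) sum.union_disjoint) auto
        then show ?thesis using F(3) unfolding dist_real_def by linarith
      qed
      also have "(\<Sum>v\<in>G \<inter> F. (norm ((A - hs_op T) v))\<^sup>2) \<le> (\<Sum>v\<in>G \<inter> F. \<delta>)"
      proof (rule sum_mono)
        fix v assume "v \<in> G \<inter> F"
        then have "(norm ((A - hs_op T) v))\<^sup>2 \<le> (sqrt \<delta>)\<^sup>2"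
          using d(2)[of v] by (intro power_mono) (auto simp: blinfun.diff_left A_in)
        then show "(norm ((A - hs_op T) v))\<^sup>2 \<le> \<delta>" using \<delta> by simp
      qed
      also have "\<dots> \<le> real (card F) * \<delta>"
        using card_mono[OF F(1), of "G \<inter> F"] \<delta> by (simp add: mult_right_mono)
      also have "\<dots> \<le> \<epsilon>\<^sup>2 / 8"
        using \<open>\<epsilon> > 0\<close> by (simp add: \<delta>_def field_simps)
      finally show ?thesis by (simp add: power_divide)
    qed
    have e2: "\<epsilon> / 2 \<ge> 0" using \<open>\<epsilon> > 0\<close> by simp
    note A' = hilbert_schmidt_boundI[OF e2 bnd]
    have "hilbert_schmidt ((A - hs_op T) + hs_op T)"
      by (intro hilbert_schmidt_add A' hilbert_schmidt_hs_op)
    then have hsA: "hilbert_schmidt A" by simp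
    then have "Abs_hs (A - hs_op T) = Abs_hs A - T"
      by (metis Abs_hs_inverse hs_op_inverse mem_Collect_eq minus_hs.rep_eq)
    then have "dist (op L) T < \<epsilon>" using A'(2) \<open>\<epsilon> > 0\<close> by (simp add: dist_norm op_def AL)
    then show ?thesis using \<open>L \<in> lists (?B \<times> D0)\<close> by (auto simp: D_def)
  qed
  ultimately show "\<exists>B::'a hs set set. countable B \<and> open = generate_topology B"
    by (rule second_countable_if_countable_dense)
qed

section \<open>The semigroup generated by a bounded operator\<close>

(* Bounded operators under composition are not an instance of real_normed_algebra_1,
   so the library exponential does not apply to them. *)

definition op_power :: "('a::real_normed_vector \<Rightarrow>\<^sub>L 'a) \<Rightarrow> nat \<Rightarrow> ('a \<Rightarrow>\<^sub>L 'a)" where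
  "op_power A n = (((o\<^sub>L) A) ^^ n) id_blinfun"

definition op_exp :: "('a::real_normed_vector \<Rightarrow>\<^sub>L 'a) \<Rightarrow> ('a \<Rightarrow>\<^sub>L 'a)" where
  "op_exp A = (\<Sum>n. (1 / fact n) *\<^sub>R op_power A n)"

lemma norm_op_power: "norm (op_power A n) \<le> norm (id_blinfun :: 'a \<Rightarrow>\<^sub>L 'a) * norm A ^ n"
  for A :: "'a::real_normed_vector \<Rightarrow>\<^sub>L 'a"
proof (induction n)
  case (Suc n)
  have "norm (op_power A (Suc n)) \<le> norm A * norm (op_power A n)"
    by (simp add: op_power_def norm_blinfun_compose)
  also have "\<dots> \<le> norm A * (norm (id_blinfun :: 'a \<Rightarrow>\<^sub>L 'a) * norm A ^ n)"
    by (intro mult_left_mono Suc.IH) simp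
  finally show ?case by (simp add: mult_ac)
qed (simp add: op_power_def)

lemma op_exp_sums:
  fixes A :: "'a::banach \<Rightarrow>\<^sub>L 'a"
  shows "(\<lambda>n. (1 / fact n) *\<^sub>R op_power A n) sums op_exp A"
  unfolding op_exp_def
proof (rule summable_sums, rule summable_comparison_test)
  have "norm ((1 / fact n) *\<^sub>R op_power A n)
      \<le> norm (id_blinfun :: 'a \<Rightarrow>\<^sub>L 'a) * (norm A ^ n /\<^sub>R fact n)" for n
    using norm_op_power[of A n] by (simp add: field_simps)
  then show "\<exists>N. \<forall>n\<ge>N. norm ((1 / fact n) *\<^sub>R op_power A n)
      \<le> norm (id_blinfun :: 'a \<Rightarrow>\<^sub>L 'a) * (norm A ^ n /\<^sub>R fact n)" by blast
  show "summable (\<lambda>n. norm (id_blinfun :: 'a \<Rightarrow>\<^sub>L 'a) * (norm A ^ n /\<^sub>R fact n))"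
    using summable_exp_generic[of "norm A"] by (rule summable_mult)
qed


section \<open>Levy processes\<close>

definition filtered :: "'w measure \<Rightarrow> (real \<Rightarrow> 'w measure) \<Rightarrow> bool" where
  "filtered M F \<longleftrightarrow> (\<forall>t\<ge>0. subalgebra M (F t)) \<and>
     (\<forall>s t. 0 \<le> s \<and> s \<le> t \<longrightarrow> sets (F s) \<subseteq> sets (F t))"

(* Time is real; only the values at nonnegative times matter. *)

definition levy_process ::
    "'w measure \<Rightarrow> (real \<Rightarrow> 'w measure) \<Rightarrow> (real \<Rightarrow> 'w \<Rightarrow> 'b::real_normed_vector) \<Rightarrow> bool" where
  "levy_process M F L \<longleftrightarrow>
     (\<forall>t\<ge>0. L t \<in> borel_measurable (F t)) \<and>
     (AE \<omega> in M. L 0 \<omega> = 0) \<and>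
     (\<forall>s t. 0 \<le> s \<and> s \<le> t \<longrightarrow>
        prob_space.indep_set M (sets (F s))
          {(\<lambda>\<omega>. L t \<omega> - L s \<omega>) -` A \<inter> space M | A. A \<in> sets borel}) \<and>
     (\<forall>s t. 0 \<le> s \<and> s \<le> t \<longrightarrow>
        distr M borel (\<lambda>\<omega>. L t \<omega> - L s \<omega>) = distr M borel (L (t - s))) \<and>
     (\<forall>t\<ge>0. \<forall>\<epsilon>>0.
        ((\<lambda>s. measure M {\<omega> \<in> space M. norm (L s \<omega> - L t \<omega>) > \<epsilon>}) \<longlongrightarrow> 0) (at t within {0..}))"

definition square_integrable_process ::
    "'w measure \<Rightarrow> (real \<Rightarrow> 'w \<Rightarrow> 'b::real_normed_vector) \<Rightarrow> bool" where
  "square_integrable_process M L \<longleftrightarrow> (\<forall>t\<ge>0. integrable M (\<lambda>\<omega>. (norm (L t \<omega>))\<^sup>2))"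

definition levy_measure :: "'b::real_normed_vector measure \<Rightarrow> bool" where
  "levy_measure \<nu> \<longleftrightarrow> sets \<nu> = sets borel \<and> emeasure \<nu> {0} = 0 \<and>
     (\<integral>\<^sup>+ z. ennreal (min 1 ((norm z)\<^sup>2)) \<partial>\<nu>) < \<infinity>"

definition covariance_operator :: "('b::real_inner \<Rightarrow>\<^sub>L 'b) \<Rightarrow> bool" where
  "covariance_operator Q \<longleftrightarrow> (\<forall>x y. Q x \<bullet> y = x \<bullet> Q y) \<and> (\<forall>x. 0 \<le> Q x \<bullet> x) \<and>
     (\<exists>B. onb B \<and> (\<lambda>e. Q e \<bullet> e) summable_on B)"

definition levy_exponent ::
    "'b::real_inner \<Rightarrow> ('b \<Rightarrow>\<^sub>L 'b) \<Rightarrow> 'b measure \<Rightarrow> 'b \<Rightarrow> complex" where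
  "levy_exponent D Q \<nu> T =
     \<i> * complex_of_real (D \<bullet> T) - 1 / 2 * complex_of_real (Q T \<bullet> T) +
     (\<integral>z. iexp (z \<bullet> T) - 1 - \<i> * complex_of_real (indicator {z. norm z \<le> 1} z * (z \<bullet> T)) \<partial>\<nu>)"

(* The characteristic triplet in the sense of the Levy-Khintchine formula, which
   determines the drift D, the Gaussian covariance Q and the Levy measure nu uniquely. *)

definition characteristic_triplet ::
    "'w measure \<Rightarrow> (real \<Rightarrow> 'w \<Rightarrow> 'b::real_inner) \<Rightarrow> 'b \<Rightarrow> ('b \<Rightarrow>\<^sub>L 'b) \<Rightarrow> 'b measure \<Rightarrow> bool" where
  "characteristic_triplet M L D Q \<nu> \<longleftrightarrow> covariance_operator Q \<and> levy_measure \<nu> \<and>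
     (\<forall>t\<ge>0. \<forall>T. (\<integral>\<omega>. iexp (L t \<omega> \<bullet> T) \<partial>M) = exp (complex_of_real t * levy_exponent D Q \<nu> T))"


section \<open>Stochastic integrals of deterministic operator-valued integrands\<close>

definition partition :: "real \<Rightarrow> nat \<Rightarrow> (nat \<Rightarrow> real) \<Rightarrow> bool" where
  "partition t n p \<longleftrightarrow> p 0 = 0 \<and> p n = t \<and> (\<forall>i<n. p i \<le> p (Suc i))"

definition step_fun :: "nat \<Rightarrow> (nat \<Rightarrow> real) \<Rightarrow> (nat \<Rightarrow> 'c::real_vector) \<Rightarrow> real \<Rightarrow> 'c" where
  "step_fun n p A s = (\<Sum>i<n. indicator {p i<..p (Suc i)} s *\<^sub>R A i)"

definition step_integral :: "(real \<Rightarrow> 'w \<Rightarrow> 'b) \<Rightarrow> nat \<Rightarrow> (nat \<Rightarrow> real) \<Rightarrow>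
    (nat \<Rightarrow> 'b::real_normed_vector \<Rightarrow>\<^sub>L 'c::real_normed_vector) \<Rightarrow> 'w \<Rightarrow> 'c" where
  "step_integral L n p A \<omega> = (\<Sum>i<n. A i (L (p (Suc i)) \<omega> - L (p i) \<omega>))"

text \<open>\<open>has_stochastic_integral M L t \<Phi> I\<close> says that the random variable \<open>I\<close> is a version of
  the stochastic integral of \<open>\<Phi>\<close> over \<open>[0, t]\<close> with respect to \<open>L\<close>, obtained by extending the
  integral of step functions by continuity, from the square-integrable integrands to the
  square-integrable random variables. For a square-integrable Levy process \<open>L\<close>, the isometry
  (and the Cauchy-Schwarz inequality for the drift) make this extension independent of the
  approximating sequence, up to null sets.
  The non-negative integrals are used because they do not degenerate to 0 when infinite.\<close>

definition has_stochastic_integral :: "'w measure \<Rightarrow> (real \<Rightarrow> 'w \<Rightarrow> 'b) \<Rightarrow> real \<Rightarrow>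
    (real \<Rightarrow> 'b::real_normed_vector \<Rightarrow>\<^sub>L 'c::real_normed_vector) \<Rightarrow> ('w \<Rightarrow> 'c) \<Rightarrow> bool" where
  "has_stochastic_integral M L t \<Phi> I \<longleftrightarrow> I \<in> borel_measurable M \<and>
     (\<exists>n p A. (\<forall>k. partition t (n k) (p k)) \<and>
        (\<lambda>k. \<integral>\<^sup>+ s\<in>{0..t}. ennreal ((norm (step_fun (n k) (p k) (A k) s - \<Phi> s))\<^sup>2) \<partial>lborel)
          \<longlonglongrightarrow> 0 \<and>
        (\<lambda>k. \<integral>\<^sup>+ \<omega>. ennreal ((norm (step_integral L (n k) (p k) (A k) \<omega> - I \<omega>))\<^sup>2) \<partial>M)
          \<longlonglongrightarrow> 0)"

definition mild_solution :: "'w measure \<Rightarrow> ('b::real_normed_vector \<Rightarrow>\<^sub>L 'b) \<Rightarrow>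
    (real \<Rightarrow> 'w \<Rightarrow> 'b) \<Rightarrow> 'b \<Rightarrow> (real \<Rightarrow> 'w \<Rightarrow> 'b) \<Rightarrow> bool" where
  "mild_solution M C L Y0 Y \<longleftrightarrow> (\<forall>t\<ge>0. Y t \<in> borel_measurable M \<and>
     (\<exists>I. has_stochastic_integral M L t (\<lambda>s. op_exp ((t - s) *\<^sub>R C)) I \<and>
        (AE \<omega> in M. Y t \<omega> = op_exp (t *\<^sub>R C) Y0 + I \<omega>)))"


section \<open>Conditional expectation of complex random variables\<close>

definition complex_cond_exp :: "'w measure \<Rightarrow> 'w measure \<Rightarrow> ('w \<Rightarrow> complex) \<Rightarrow> 'w \<Rightarrow> complex" where
  "complex_cond_exp M G X \<omega> =
     Complex (real_cond_exp M G (\<lambda>\<omega>. Re (X \<omega>)) \<omega>) (real_cond_exp M G (\<lambda>\<omega>. Im (X \<omega>)) \<omega>)"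

end

(* Split the stochastic integral of S(t - u) over (0, t] at s. The part over (0, s] is S(t - s)
   applied to the integral of S(s - u), hence F_s-measurable up to null sets, and the part over
   (s, t] is independent of F_s. For step integrands f the characteristic function of the integral
   is exp of the integral of the Levy exponent Psi along f, by induction on the number of break
   points, and it passes to L2 limits because |Psi(x + h) - Psi(x)| <= eps + C |h|^2 uniformly on
   bounded sets of x.

   Y(t) and Y(s) come with unrelated approximating sequences. They are compared without the
   isometry: the same formula, applied to the difference of the two step integrands on (0, s],
   shows that the characteristic function of the difference of the integrals tends to 1. *)

theory Submission
  imports Defs
begin


section \<open>Adjoints and the exponential of a bounded operator\<close>

text \<open>The obstacle is that step functions approximating the integrand are controlled in L2
  only, without any uniform bound, while Psi may grow quadratically. A modulus of the form eps + C
  |h|^2 fits this situation: L2 convergence pays for the quadratic term, and eps only meets an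
  interval of finite length. Young's inequality brings every first order term into that form, and
  the same pattern serves for the exponentials of the integrals.

  All integrals are tested against one fixed vector x, so an operator integrand A enters only
  through the vector function u -> adjoint (A u) x. Vectors live in a separable space, where
  measurability is unproblematic; the space of bounded operators need not be separable. This is why
  the existence of adjoints, and with it Riesz representation, comes at the start.

  Conditioning needs care with null sets: a mild solution is measurable only for M, and F_s need not
  contain the null sets. The conditional expectation is therefore identified through an
  F_s-measurable function that agrees almost everywhere with the exponential of Y(s).\<close>

lemma riesz_representation:
  fixes \<phi> :: "'a::{real_inner,banach} \<Rightarrow> real"
  assumes "bounded_linear \<phi>"
  shows "\<exists>z. \<forall>x. \<phi> x = x \<bullet> z"
proof -
  interpret bounded_linear \<phi> by fact
  \<comment> \<open>If z represents \<phi>, then J x = |x - z|^2 - |z|^2, so z can be found as the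
    minimiser of J.\<close>
  define J where "J x = (norm x)\<^sup>2 - 2 * \<phi> x" for x
  define m where "m = (INF x. J x)"
  have bdd: "bdd_below (range J)"
  proof (rule bdd_belowI2)
    fix x
    have "\<phi> x \<le> onorm \<phi> * norm x" using onorm[OF assms, of x] by simp
    moreover have "0 \<le> (norm x - onorm \<phi>)\<^sup>2" by simp
    ultimately show "- (onorm \<phi>)\<^sup>2 \<le> J x"
      by (simp add: J_def power2_diff mult.commute)
  qed
  have m_le: "m \<le> J x" for x
    unfolding m_def using bdd by (rule cINF_lower) simp
  have "\<exists>x. J x < m + 1 / real (Suc n)" for n
    using cINF_less_iff[OF _ bdd, of "m + 1 / real (Suc n)"] unfolding m_def by auto
  then obtain x where x: "\<And>n. J (x n) < m + 1 / real (Suc n)" by metis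
  \<comment> \<open>Parallelogram law: the linear part of J cancels. Since J is at least m at the
    midpoint, a minimising sequence is Cauchy.\<close>
  have par: "(norm (u - v))\<^sup>2 = 2 * J u + 2 * J v - 4 * J ((1/2) *\<^sub>R (u + v))" for u v
    unfolding J_def
    by (simp add: power2_norm_eq_inner inner_commute algebra_simps add scaleR)
  have "Cauchy x"
  proof (rule CauchyI)
    fix e :: real assume "e > 0"
    \<comment> \<open>Each of the two values enters \<open>par\<close> with the factor 2, so
      excesses of e^2/4 add up to e^2.\<close>
    then obtain N where N: "1 / real (Suc N) < e\<^sup>2 / 4"
      using reals_Archimedean[of "e\<^sup>2 / 4"] by (auto simp: inverse_eq_divide)
    have le: "J (x n) < m + e\<^sup>2 / 4" if "n \<ge> N" for n
    proof -
      have "1 / real (Suc n) \<le> 1 / real (Suc N)" using that by (intro divide_left_mono) auto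
      then show ?thesis using x[of n] N by linarith
    qed
    have "norm (x p - x q) < e" if "p \<ge> N" "q \<ge> N" for p q
    proof (rule power2_less_imp_less)
      show "(norm (x p - x q))\<^sup>2 < e\<^sup>2"
        unfolding par using le[OF that(1)] le[OF that(2)] m_le[of "(1/2) *\<^sub>R (x p + x q)"] by linarith
    qed (use \<open>e > 0\<close> in simp)
    then show "\<exists>M. \<forall>p\<ge>M. \<forall>q\<ge>M. norm (x p - x q) < e" by blast
  qed
  then obtain z where z: "x \<longlonglongrightarrow> z" by (auto simp: Cauchy_convergent_iff convergent_def)
  have Jz: "J z \<le> m"
  proof (rule LIMSEQ_le)
    show "(\<lambda>n. J (x n)) \<longlonglongrightarrow> J z"
      unfolding J_def by (intro tendsto_intros tendsto z)
    show "(\<lambda>n. m + 1 / real (Suc n)) \<longlonglongrightarrow> m"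
      using tendsto_add[OF tendsto_const LIMSEQ_inverse_real_of_nat, of m] by (simp add: inverse_eq_divide)
    show "\<exists>N. \<forall>n\<ge>N. J (x n) \<le> m + 1 / real (Suc n)" using x less_imp_le by blast
  qed
  have "\<phi> y = y \<bullet> z" for y
  proof -
    define d where "d = y \<bullet> z - \<phi> y"
    \<comment> \<open>Variation of J at its minimiser in the direction y: nonnegativity for every r
      forces the linear coefficient d to vanish.\<close>
    have *: "0 \<le> 2 * r * d + r\<^sup>2 * (norm y)\<^sup>2" for r
    proof -
      have "J z \<le> J (z + r *\<^sub>R y)" using Jz m_le[of "z + r *\<^sub>R y"] by linarith
      moreover have "J (z + r *\<^sub>R y) = J z + 2 * r * d + r\<^sup>2 * (norm y)\<^sup>2"
        unfolding J_def d_def power2_norm_eq_inner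
        by (simp add: inner_commute algebra_simps add scaleR power2_eq_square)
      ultimately show ?thesis by linarith
    qed
    show ?thesis
    proof (cases "y = 0")
      case True
      then show ?thesis by (simp add: zero)
    next
      case False
      then have n: "(norm y)\<^sup>2 > 0" by simp
      define N where "N = (norm y)\<^sup>2"
      \<comment> \<open>r = - d / N minimises the quadratic polynomial in r.\<close>
      have "0 \<le> 2 * (- d / N) * d + (- d / N)\<^sup>2 * N" using *[of "- d / N"] by (simp add: N_def)
      also have "\<dots> = - (d\<^sup>2 / N)"
        using n by (simp add: N_def field_simps power2_eq_square)
      finally have "d\<^sup>2 \<le> 0" using n by (simp add: N_def field_simps)
      then show ?thesis by (simp add: d_def)
    qed
  qed
  then show ?thesis by blast
qed

text \<open>\<open>adjoint\<close> is a choice among the functions g with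
  \<open>A x \<bullet> y = x \<bullet> g y\<close>; Riesz representation of x -> A x \<bullet> y,
  for each y, shows that there is one to choose.\<close>

lemma blinfun_adjoint:
  fixes A :: "'a::{real_inner,banach} \<Rightarrow>\<^sub>L 'b::real_inner"
  shows "A x \<bullet> y = x \<bullet> adjoint A y"
proof -
  have "\<exists>z. \<forall>x. A x \<bullet> y = x \<bullet> z" for y
    by (intro riesz_representation bounded_linear_inner_left_comp blinfun.bounded_linear_right)
  then have "\<exists>g. \<forall>x y. A x \<bullet> y = x \<bullet> g y" by metis
  from someI_ex[OF this] show ?thesis unfolding adjoint_def by blast
qed

text \<open>Linearity in the operator for a fixed vector: the adjoint of a step function is again a
  step function, and E -> adjoint E y is continuous.\<close>

lemma adjoint_blinfun_linear:
  fixes A B :: "'a::{real_inner,banach} \<Rightarrow>\<^sub>L 'b::real_inner"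
  shows "adjoint (A - B) y = adjoint A y - adjoint B y"
    and "adjoint (A + B) y = adjoint A y + adjoint B y"
    and "adjoint (r *\<^sub>R A) y = r *\<^sub>R adjoint A y"
  by (rule vector_eq_ldot[THEN iffD1], rule allI,
      simp add: blinfun_adjoint[symmetric] inner_diff_left inner_diff_right inner_add_left
        inner_add_right blinfun.diff_left blinfun.add_left blinfun.scaleR_left)+

lemma adjoint_blinfun_sum:
  fixes A :: "'i \<Rightarrow> 'a::{real_inner,banach} \<Rightarrow>\<^sub>L 'b::real_inner"
  shows "adjoint (\<Sum>i\<in>I. A i) y = (\<Sum>i\<in>I. adjoint (A i) y)"
  by (induction I rule: infinite_finite_induct)
    (simp_all add: adjoint_blinfun_linear adjoint_unique[where f = "\<lambda>_. 0" and g = "\<lambda>_. 0"])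

lemma adjoint_blinfun_compose:
  fixes B :: "'a::{real_inner,banach} \<Rightarrow>\<^sub>L 'b::{real_inner,banach}" and A :: "'b \<Rightarrow>\<^sub>L 'c::real_inner"
  shows "adjoint (A o\<^sub>L B) y = adjoint B (adjoint A y)"
  by (rule vector_eq_ldot[THEN iffD1], rule allI) (simp add: blinfun_adjoint[symmetric])

text \<open>Testing the adjoint identity at z = adjoint A y gives |z|^2 \<le> |A| |z| |y|, and one
  factor |z| cancels.\<close>

lemma norm_adjoint_blinfun_le:
  fixes A :: "'a::{real_inner,banach} \<Rightarrow>\<^sub>L 'b::real_inner"
  shows "norm (adjoint A y) \<le> norm A * norm y"
proof -
  let ?z = "adjoint A y"
  have "norm ?z * norm ?z = A ?z \<bullet> y"
    unfolding blinfun_adjoint by (simp add: power2_norm_eq_inner[symmetric] power2_eq_square)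
  also have "\<dots> \<le> norm (A ?z) * norm y" by (rule norm_cauchy_schwarz)
  also have "\<dots> \<le> (norm A * norm ?z) * norm y" by (intro mult_right_mono norm_blinfun) simp
  finally have "norm ?z * norm ?z \<le> (norm A * norm y) * norm ?z" by (simp add: mult_ac)
  then show ?thesis by (cases "norm ?z = 0") (simp_all add: mult_le_cancel_right)
qed

section \<open>Powers and the exponential series of a bounded operator\<close>

lemma op_power_add: "op_power A (m + n) = op_power A m o\<^sub>L op_power A n"
  by (induction m) (auto simp: op_power_def intro!: blinfun_eqI)

lemma op_power_scaleR: "op_power (r *\<^sub>R A) n = r ^ n *\<^sub>R op_power A n"
  by (induction n) (auto simp: op_power_def blinfun.scaleR_left blinfun.scaleR_right intro!: blinfun_eqI)

lemma summable_norm_op_exp: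
  fixes A :: "'a::real_normed_vector \<Rightarrow>\<^sub>L 'a"
  shows "summable (\<lambda>n. norm ((1 / fact n) *\<^sub>R op_power A n))"
proof (rule summable_comparison_test')
  show "summable (\<lambda>n. norm (id_blinfun :: 'a \<Rightarrow>\<^sub>L 'a) * (norm A ^ n /\<^sub>R fact n))"
    using summable_exp_generic[of "norm A"] by (rule summable_mult)
  show "norm (norm ((1 / fact n) *\<^sub>R op_power A n))
    \<le> norm (id_blinfun :: 'a \<Rightarrow>\<^sub>L 'a) * (norm A ^ n /\<^sub>R fact n)" for n
    using norm_op_power[of A n] by (simp add: field_simps)
qed

text \<open>Unconditional summation is the form that survives the regrouping of a double series in
  \<open>op_exp_add\<close>.\<close>

lemma has_sum_op_exp:
  fixes A :: "'a::banach \<Rightarrow>\<^sub>L 'a"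
  shows "((\<lambda>n. (1 / fact n) *\<^sub>R op_power A n) has_sum op_exp A) UNIV"
  using norm_summable_imp_has_sum[OF summable_norm_op_exp op_exp_sums] .

lemma binomial_fact_scaled:
  fixes r s :: real
  shows "(\<Sum>k\<le>n. r ^ k * s ^ (n - k) / (fact k * fact (n - k))) = (r + s) ^ n / fact n"
  unfolding binomial_ring sum_divide_distrib
  by (rule sum.cong) (simp_all add: binomial_fact)

text \<open>Cauchy product: the doubly indexed family is absolutely summable; by rows it sums to the
  composition, along antidiagonals to the series of the left-hand side. Both factors are power
  series in the same A, so the powers merge.\<close>

lemma op_exp_add:
  fixes A :: "'a::banach \<Rightarrow>\<^sub>L 'a"
  shows "op_exp ((r + s) *\<^sub>R A) = op_exp (r *\<^sub>R A) o\<^sub>L op_exp (s *\<^sub>R A)"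
proof -
  let ?f = "\<lambda>m. (1 / fact m) *\<^sub>R op_power (r *\<^sub>R A) m"
  let ?g = "\<lambda>n. (1 / fact n) *\<^sub>R op_power (s *\<^sub>R A) n"
  let ?h = "\<lambda>(m, n). ?f m o\<^sub>L ?g n"
  have "(\<lambda>m. norm (?f m)) summable_on UNIV" "(\<lambda>n. norm (?g n)) summable_on UNIV"
    by (intro summable_nonneg_imp_summable_on summable_norm_op_exp norm_ge_zero)+
  then have prod: "(\<lambda>(m, n). norm (?f m) * norm (?g n)) summable_on UNIV \<times> UNIV"
    by (intro summable_on_SigmaI[where g = "\<lambda>m. norm (?f m) * (\<Sum>\<^sub>\<infinity>n. norm (?g n))"])
      (auto simp del: norm_scaleR intro: has_sum_cmult_right summable_on_cmult_left)
  have "(\<lambda>z. norm (?h z)) summable_on UNIV \<times> UNIV"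
    by (rule summable_on_comparison_test[OF prod])
      (auto simp: split_beta simp del: norm_scaleR intro: norm_blinfun_compose)
  then have summ: "?h summable_on UNIV \<times> UNIV" by (rule abs_summable_summable)
  have 1: "(?h has_sum (op_exp (r *\<^sub>R A) o\<^sub>L op_exp (s *\<^sub>R A))) (UNIV \<times> UNIV)"
  proof (rule has_sum_SigmaI[OF _ _ summ])
    show "((\<lambda>n. ?h (m, n)) has_sum (?f m o\<^sub>L op_exp (s *\<^sub>R A))) UNIV" for m
      using has_sum_bounded_linear[OF bounded_bilinear.bounded_linear_right[OF bounded_bilinear_blinfun_compose] has_sum_op_exp]
      by simp
    show "((\<lambda>m. ?f m o\<^sub>L op_exp (s *\<^sub>R A)) has_sum (op_exp (r *\<^sub>R A) o\<^sub>L op_exp (s *\<^sub>R A))) UNIV"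
      using has_sum_bounded_linear[OF bounded_bilinear.bounded_linear_left[OF bounded_bilinear_blinfun_compose] has_sum_op_exp] .
  qed
  \<comment> \<open>The pair (m, n) becomes (m + n, m), so the fibre over a total degree is its
    antidiagonal.\<close>
  have 2: "((\<lambda>(n, k). ?h (k, n - k)) has_sum (op_exp (r *\<^sub>R A) o\<^sub>L op_exp (s *\<^sub>R A))) (SIGMA n:UNIV. {..n})"
    using 1 by (subst has_sum_reindex_bij_witness[where i = "\<lambda>(m, n). (m + n, m)" and j = "\<lambda>(n, k). (k, n - k)"
        and T = "UNIV \<times> UNIV" and h = ?h]) auto
  have "((\<lambda>n. (1 / fact n) *\<^sub>R op_power ((r + s) *\<^sub>R A) n) has_sum (op_exp (r *\<^sub>R A) o\<^sub>L op_exp (s *\<^sub>R A))) UNIV"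
  proof (rule has_sum_SigmaD[OF 2])
    fix n
    have "?h (k, n - k) = (r ^ k * s ^ (n - k) / (fact k * fact (n - k))) *\<^sub>R op_power A n" if "k \<le> n" for k
      using op_power_add[of A k "n - k"] that
      by (auto simp: op_power_scaleR blinfun.scaleR_left blinfun.scaleR_right mult.commute intro!: blinfun_eqI)
    then have "(\<Sum>k\<le>n. ?h (k, n - k)) = ((r + s) ^ n / fact n) *\<^sub>R op_power A n"
      by (simp add: binomial_fact_scaled[symmetric] scaleR_sum_left)
    then show "((\<lambda>k. case (n, k) of (n, k) \<Rightarrow> ?h (k, n - k)) has_sum (1 / fact n) *\<^sub>R op_power ((r + s) *\<^sub>R A) n) {..n}"
      by (intro has_sum_finiteI) (simp_all add: op_power_scaleR)
  qed
  then show ?thesis using has_sum_op_exp has_sum_unique by blast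
qed

text \<open>On a bounded time interval the series is dominated by its value at |u| = R, so the
  partial sums, polynomials in u, converge uniformly.\<close>

lemma continuous_on_op_exp:
  fixes A :: "'a::banach \<Rightarrow>\<^sub>L 'a"
  shows "continuous_on {- R..R} (\<lambda>u. op_exp (u *\<^sub>R A))"
proof (rule uniform_limit_theorem[where F = sequentially])
  show "uniform_limit {- R..R} (\<lambda>n u. \<Sum>i<n. (1 / fact i) *\<^sub>R op_power (u *\<^sub>R A) i)
     (\<lambda>u. op_exp (u *\<^sub>R A)) sequentially"
    unfolding op_exp_def
  proof (rule Weierstrass_m_test)
    let ?K = "norm (id_blinfun :: 'a \<Rightarrow>\<^sub>L 'a)"
    show "summable (\<lambda>n. ?K * ((R * norm A) ^ n /\<^sub>R fact n))"
      using summable_exp_generic[of "R * norm A"] by (rule summable_mult)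
    fix n u assume u: "u \<in> {- R..R}"
    have "norm (op_power (u *\<^sub>R A) n) \<le> ?K * (\<bar>u\<bar> * norm A) ^ n"
      using norm_op_power[of "u *\<^sub>R A" n] by simp
    also have "\<dots> \<le> ?K * (R * norm A) ^ n"
      using u by (intro mult_left_mono power_mono mult_right_mono) auto
    finally show "norm ((1 / fact n) *\<^sub>R op_power (u *\<^sub>R A) n) \<le> ?K * ((R * norm A) ^ n /\<^sub>R fact n)"
      by (simp add: field_simps)
  qed
  show "\<forall>\<^sub>F n in sequentially. continuous_on {- R..R} (\<lambda>u. \<Sum>i<n. (1 / fact i) *\<^sub>R op_power (u *\<^sub>R A) i)"
    unfolding op_power_scaleR by (intro always_eventually allI continuous_intros)
qed simp

text \<open>For fixed x the map E -> adjoint E x is bounded linear with constant norm x, so it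
  preserves continuity; every u is interior to some interval [-R, R].\<close>

lemma continuous_adjoint_op_exp:
  fixes A :: "'a::{real_inner,banach} \<Rightarrow>\<^sub>L 'a"
  shows "continuous_on UNIV (\<lambda>u. adjoint (op_exp (u *\<^sub>R A)) x)"
proof -
  have "continuous_on {- R..R} (\<lambda>u. adjoint (op_exp (u *\<^sub>R A)) x)" for R
  proof (rule continuous_on_compose2[OF _ continuous_on_op_exp subset_UNIV])
    show "continuous_on UNIV (\<lambda>E :: 'a \<Rightarrow>\<^sub>L 'a. adjoint E x)"
      by (intro linear_continuous_on bounded_linear_intro[where K = "norm x"])
        (auto simp: adjoint_blinfun_linear norm_adjoint_blinfun_le)
  qed
  then have "isCont (\<lambda>u. adjoint (op_exp (u *\<^sub>R A)) x) u" for u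
    by (rule continuous_on_interior[of "{- (\<bar>u\<bar> + 1)..\<bar>u\<bar> + 1}"]) (auto simp: interior_atLeastAtMost_real)
  then show ?thesis by (simp add: continuous_on_eq_continuous_at)
qed


section \<open>Continuity of the Levy exponent\<close>

lemma cmod_iexp_minus_1: "cmod (iexp x - 1) \<le> \<bar>x\<bar>" "cmod (iexp x - 1) \<le> 2"
  using iexp_approx1[of x 0] norm_triangle_ineq4[of "iexp x" 1] by simp_all

lemma cmod_iexp_diff: "cmod (iexp x - iexp y) \<le> \<bar>x - y\<bar>"
proof -
  have "iexp x - iexp y = iexp y * (iexp (x - y) - 1)"
    by (simp add: algebra_simps flip: exp_add)
  then show ?thesis using cmod_iexp_minus_1(1)[of "x - y"] by (simp add: norm_mult)
qed

lemma cmod_iexp_minus_1_minus: "cmod (iexp x - 1 - \<i> * x) \<le> x\<^sup>2"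
proof -
  have "cmod (iexp x - 1 - \<i> * x) \<le> x\<^sup>2 / 2"
    using iexp_approx1[of x 1] by (simp add: power2_eq_square diff_diff_eq)
  also have "\<dots> \<le> x\<^sup>2" by simp
  finally show ?thesis .
qed

text \<open>The integrand of the jump part of \<open>levy_exponent\<close>, named so that it can be
  estimated pointwise in z before integration.\<close>

definition levy_jump :: "'b::real_inner \<Rightarrow> 'b \<Rightarrow> complex" where
  "levy_jump x z = iexp (z \<bullet> x) - 1 - \<i> * complex_of_real (indicator {z. norm z \<le> 1} z * (z \<bullet> x))"

text \<open>Three ranges of jumps. For |z| \<le> 1 the compensator removes the first order in z,
  leaving |z|^2; for 1 < |z| \<le> N the difference is at most N |h|; beyond N only the trivial
  bound 2 remains, and a large N will make that part small after integration.\<close>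

lemma cmod_levy_jump_diff:
  assumes "N \<ge> 1"
  shows "cmod (levy_jump (x + h) z - levy_jump x z) \<le>
    ((norm h)\<^sup>2 + norm x * norm h + N * norm h) * min 1 ((norm z)\<^sup>2)
      + 2 * (indicator {z. norm z > N} z * min 1 ((norm z)\<^sup>2))"
proof -
  let ?a = "z \<bullet> x" and ?b = "z \<bullet> h"
  have b: "\<bar>?b\<bar> \<le> norm z * norm h" and a: "\<bar>?a\<bar> \<le> norm z * norm x"
    by (rule Cauchy_Schwarz_ineq2)+
  have nn: "0 \<le> (norm h)\<^sup>2 + norm x * norm h" "0 \<le> N * norm h"
    using assms by simp_all
  show ?thesis
  proof (cases "norm z \<le> 1")
    case True
    then have z: "min 1 ((norm z)\<^sup>2) = (norm z)\<^sup>2" by (simp add: power_le_one)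
    \<comment> \<open>Both summands are of second order in z: a Taylor remainder, and a product of
      two first order differences.\<close>
    have "levy_jump (x + h) z - levy_jump x z
        = (iexp ?b - 1 - \<i> * ?b) + (iexp ?a - 1) * (iexp ?b - 1)"
      using True by (simp add: levy_jump_def algebra_simps inner_add_right exp_add)
    also have "cmod \<dots> \<le> ?b\<^sup>2 + \<bar>?a\<bar> * \<bar>?b\<bar>"
      by (intro norm_triangle_mono cmod_iexp_minus_1_minus)
        (auto simp: norm_mult intro!: mult_mono cmod_iexp_minus_1(1))
    also have "\<dots> \<le> (norm z * norm h)\<^sup>2 + (norm z * norm x) * (norm z * norm h)"
      using b power_mono[OF b, of 2] by (intro add_mono mult_mono a b) auto
    also have "\<dots> = ((norm h)\<^sup>2 + norm x * norm h) * (norm z)\<^sup>2"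
      by (simp add: power2_eq_square algebra_simps)
    also have "\<dots> \<le> ((norm h)\<^sup>2 + norm x * norm h + N * norm h) * (norm z)\<^sup>2"
      using nn by (intro mult_right_mono) auto
    also have "\<dots> \<le> \<dots> + 2 * (indicator {z. norm z > N} z * min 1 ((norm z)\<^sup>2))"
      by simp
    finally show ?thesis unfolding z .
  next
    case False
    then have z: "min 1 ((norm z)\<^sup>2) = 1" by (simp add: one_le_power)
    have "levy_jump (x + h) z - levy_jump x z = iexp ?a * (iexp ?b - 1)"
      using False by (simp add: levy_jump_def algebra_simps inner_add_right exp_add)
    then have *: "cmod (levy_jump (x + h) z - levy_jump x z) = cmod (iexp ?b - 1)"
      by (simp add: norm_mult)
    show ?thesis
    proof (cases "norm z \<le> N")
      case True
      have "cmod (iexp ?b - 1) \<le> norm z * norm h" using cmod_iexp_minus_1(1) b order_trans by blast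
      also have "\<dots> \<le> N * norm h" using True by (intro mult_right_mono) auto
      finally show ?thesis unfolding z * using nn True by (auto intro: add_increasing)
    next
      case False
      then show ?thesis unfolding z * using cmod_iexp_minus_1(2)[of ?b] nn by (auto intro: add_increasing)
    qed
  qed
qed

section \<open>Integrability against a Levy measure\<close>

lemma borel_measurable_levy_measure:
  assumes "levy_measure \<nu>"
  shows "borel_measurable \<nu> = borel_measurable borel"
  using assms by (intro measurable_cong_sets) (auto simp: levy_measure_def)

lemma integrable_levy_weight:
  fixes \<nu> :: "'b::real_normed_vector measure"
  assumes "levy_measure \<nu>"
  shows "integrable \<nu> (\<lambda>z. min 1 ((norm z)\<^sup>2))"
proof (rule integrableI_nonneg)
  show "(\<lambda>z. min 1 ((norm z)\<^sup>2)) \<in> borel_measurable \<nu>"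
    unfolding borel_measurable_levy_measure[OF assms] by simp
qed (use assms in \<open>auto simp: levy_measure_def\<close>)

text \<open>The integrand vanishes at x = 0, so the difference bound with base point 0, increment x
  and cut-off N = 1 is a majorant.\<close>

lemma integrable_levy_jump:
  fixes \<nu> :: "'b::{real_inner,second_countable_topology} measure"
  assumes "levy_measure \<nu>"
  shows "integrable \<nu> (levy_jump x)"
proof (rule Bochner_Integration.integrable_bound)
  show "integrable \<nu> (\<lambda>z. ((norm x)\<^sup>2 + norm x + 2) * min 1 ((norm z)\<^sup>2))"
    by (intro integrable_mult_right integrable_levy_weight assms)
  show "levy_jump x \<in> borel_measurable \<nu>"
    unfolding borel_measurable_levy_measure[OF assms] levy_jump_def[abs_def] by measurable
  have "cmod (levy_jump x z) \<le> ((norm x)\<^sup>2 + norm x + 2) * min 1 ((norm z)\<^sup>2)" for z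
  proof -
    have "cmod (levy_jump x z) \<le> ((norm x)\<^sup>2 + norm x) * min 1 ((norm z)\<^sup>2)
      + 2 * (indicator {z. norm z > 1} z * min 1 ((norm z)\<^sup>2))"
      using cmod_levy_jump_diff[of 1 0 x z] by (simp add: levy_jump_def)
    also have "\<dots> \<le> ((norm x)\<^sup>2 + norm x) * min 1 ((norm z)\<^sup>2) + 2 * min 1 ((norm z)\<^sup>2)"
      by (auto simp: indicator_def)
    finally show ?thesis by (simp add: algebra_simps)
  qed
  then show "AE z in \<nu>. norm (levy_jump x z) \<le> norm (((norm x)\<^sup>2 + norm x + 2) * min 1 ((norm z)\<^sup>2))"
    by (auto simp: abs_mult)
qed

text \<open>Dominated convergence with the weight itself as majorant: for fixed z the indicator is 0
  once n \<ge> |z|.\<close>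

lemma levy_weight_tail:
  fixes \<nu> :: "'b::real_normed_vector measure"
  assumes "levy_measure \<nu>" "\<epsilon> > 0"
  shows "\<exists>N\<ge>1. (\<integral>z. indicator {z. norm z > N} z * min 1 ((norm z)\<^sup>2) \<partial>\<nu>) < \<epsilon>"
proof -
  have "(\<lambda>n. \<integral>z. indicator {z. norm z > real n} z * min 1 ((norm z)\<^sup>2) \<partial>\<nu>) \<longlonglongrightarrow> (\<integral>z. 0 \<partial>\<nu>)"
  proof (rule integral_dominated_convergence)
    show "integrable \<nu> (\<lambda>z. min 1 ((norm z)\<^sup>2))" by (rule integrable_levy_weight[OF assms(1)])
    have "(\<lambda>n. indicator {z. norm z > real n} z * min 1 ((norm z)\<^sup>2)) \<longlonglongrightarrow> 0" for z :: 'b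
    proof (rule tendsto_eventually, rule eventually_sequentiallyI)
      fix n assume "nat \<lceil>norm z\<rceil> \<le> n"
      then have "norm z \<le> real n" by (simp add: nat_le_iff ceiling_le_iff)
      then show "indicator {z. norm z > real n} z * min 1 ((norm z)\<^sup>2) = (0::real)" by simp
    qed
    then show "AE z in \<nu>. (\<lambda>n. indicator {z. norm z > real n} z * min 1 ((norm z)\<^sup>2)) \<longlonglongrightarrow> (0::real)" by simp
  next
    fix n show "(\<lambda>z. indicator {z. norm z > real n} z * min 1 ((norm z)\<^sup>2) :: real) \<in> borel_measurable \<nu>"
      unfolding borel_measurable_levy_measure[OF assms(1)] by measurable
    show "AE z in \<nu>. norm (indicator {z. norm z > real n} z * min 1 ((norm z)\<^sup>2) :: real) \<le> min 1 ((norm z)\<^sup>2)"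
      by (auto simp: indicator_def)
  qed simp
  then have "\<forall>\<^sub>F n in sequentially. (\<integral>z. indicator {z. norm z > real n} z * min 1 ((norm z)\<^sup>2) \<partial>\<nu>) < \<epsilon>"
    using assms(2) by (intro order_tendstoD) simp_all
  then have "\<forall>\<^sub>F n in sequentially. n \<ge> 1 \<and> (\<integral>z. indicator {z. norm z > real n} z * min 1 ((norm z)\<^sup>2) \<partial>\<nu>) < \<epsilon>"
    by (intro eventually_conj eventually_ge_at_top)
  then obtain n :: nat where "n \<ge> 1" "(\<integral>z. indicator {z. norm z > real n} z * min 1 ((norm z)\<^sup>2) \<partial>\<nu>) < \<epsilon>"
    by (auto simp: eventually_sequentially)
  then show ?thesis by (intro exI[of _ "real n"]) auto
qed

text \<open>Trades a first order term for an arbitrarily small constant and a second order term; C =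
  c^2 / \<epsilon> comes from expanding (\<epsilon> - c y)^2 \<ge> 0.\<close>

lemma young_square: "\<exists>C\<ge>0. \<forall>y\<ge>0. c * y \<le> \<epsilon> + C * y\<^sup>2" if "\<epsilon> > 0" for c \<epsilon> :: real
proof (intro exI[of _ "c\<^sup>2 / \<epsilon>"] conjI allI impI)
  fix y :: real assume "y \<ge> 0"
  have "0 \<le> (\<epsilon> - c * y)\<^sup>2" by simp
  then have "2 * (\<epsilon> * (c * y)) \<le> \<epsilon>\<^sup>2 + c\<^sup>2 * y\<^sup>2"
    by (simp add: power2_diff power_mult_distrib)
  moreover have "0 \<le> \<epsilon>\<^sup>2 + c\<^sup>2 * y\<^sup>2" by simp
  ultimately have "\<epsilon> * (c * y) \<le> \<epsilon>\<^sup>2 + c\<^sup>2 * y\<^sup>2" by linarith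
  then show "c * y \<le> \<epsilon> + c\<^sup>2 / \<epsilon> * y\<^sup>2" using that by (simp add: field_simps power2_eq_square)
qed (use that in simp)

text \<open>Only the base point x is confined to a ball; h is arbitrary, as needed for
  approximations that are not uniformly bounded. The cut-off N for large jumps is fixed first, which
  makes all other coefficients finite; Young's inequality then absorbs what is linear in
  |h|.\<close>

lemma levy_exponent_diff:
  fixes D :: "'b::{real_inner,second_countable_topology}"
  assumes \<nu>: "levy_measure \<nu>" and "\<epsilon> > 0" and R: "R \<ge> 0"
  shows "\<exists>C\<ge>0. \<forall>x h. norm x \<le> R \<longrightarrow>
    cmod (levy_exponent D Q \<nu> (x + h) - levy_exponent D Q \<nu> x) \<le> \<epsilon> + C * (norm h)\<^sup>2"
proof -
  \<comment> \<open>The large jumps carry the factor 2 of the trivial bound, so \<epsilon> / 4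
    leaves half of \<epsilon> for Young's inequality.\<close>
  obtain N where N: "N \<ge> 1" "(\<integral>z. indicator {z. norm z > N} z * min 1 ((norm z)\<^sup>2) \<partial>\<nu>) < \<epsilon> / 4"
    using levy_weight_tail[OF \<nu>, of "\<epsilon> / 4"] \<open>\<epsilon> > 0\<close> by auto
  define w where "w = (\<integral>z. min 1 ((norm z)\<^sup>2) \<partial>\<nu>)"
  have w0: "w \<ge> 0" by (simp add: w_def)
  define C1 where "C1 = norm D + norm Q * R + (R + N) * w"
  define C2 where "C2 = norm Q + w"
  have C1: "C1 \<ge> 0" and C2: "C2 \<ge> 0" using w0 N R by (auto simp: C1_def C2_def)
  have main: "cmod (levy_exponent D Q \<nu> (x + h) - levy_exponent D Q \<nu> x)
      \<le> \<epsilon> / 2 + C1 * norm h + C2 * (norm h)\<^sup>2" if x: "norm x \<le> R" for x h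
  proof -
    \<comment> \<open>The outer factor 2 is there to cancel the 1/2 in front of the Gaussian
      term.\<close>
    have quad: "\<bar>Q (x + h) \<bullet> (x + h) - Q x \<bullet> x\<bar> \<le> 2 * (norm Q * (R * norm h) + norm Q * (norm h)\<^sup>2)"
    proof -
      have cs: "\<bar>Q u \<bullet> v\<bar> \<le> norm Q * (norm u * norm v)" for u v
      proof -
        have "\<bar>Q u \<bullet> v\<bar> \<le> norm (Q u) * norm v" by (rule Cauchy_Schwarz_ineq2)
        also have "\<dots> \<le> (norm Q * norm u) * norm v" by (intro mult_right_mono norm_blinfun) simp
        finally show ?thesis by (simp add: mult_ac)
      qed
      have "norm Q * (norm x * norm h) \<le> norm Q * (R * norm h)"
        using x by (intro mult_left_mono mult_right_mono) auto
      moreover have "Q (x + h) \<bullet> (x + h) - Q x \<bullet> x = Q x \<bullet> h + Q h \<bullet> x + Q h \<bullet> h"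
        by (simp add: blinfun.add_right inner_add_left inner_add_right)
      ultimately show ?thesis
        using cs[of x h] cs[of h x] cs[of h h] by (simp add: power2_eq_square mult.commute[of "norm h" "norm x"])
    qed
    have jump: "cmod ((\<integral>z. levy_jump (x + h) z \<partial>\<nu>) - (\<integral>z. levy_jump x z \<partial>\<nu>))
        \<le> ((norm h)\<^sup>2 + R * norm h + N * norm h) * w + \<epsilon> / 2"
    proof -
      have int: "integrable \<nu> (\<lambda>z. indicator {z. norm z > N} z * min 1 ((norm z)\<^sup>2))"
      proof (rule Bochner_Integration.integrable_bound[OF integrable_levy_weight[OF \<nu>]])
        show "(\<lambda>z. indicator {z. norm z > N} z * min 1 ((norm z)\<^sup>2) :: real) \<in> borel_measurable \<nu>"
          unfolding borel_measurable_levy_measure[OF \<nu>] by measurable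
      qed (auto simp: indicator_def)
      have "cmod ((\<integral>z. levy_jump (x + h) z \<partial>\<nu>) - (\<integral>z. levy_jump x z \<partial>\<nu>))
          = cmod (\<integral>z. levy_jump (x + h) z - levy_jump x z \<partial>\<nu>)"
        by (simp add: integrable_levy_jump[OF \<nu>])
      also have "\<dots> \<le> (\<integral>z. cmod (levy_jump (x + h) z - levy_jump x z) \<partial>\<nu>)"
        by (rule integral_norm_bound)
      also have "\<dots> \<le> (\<integral>z. ((norm h)\<^sup>2 + norm x * norm h + N * norm h) * min 1 ((norm z)\<^sup>2)
          + 2 * (indicator {z. norm z > N} z * min 1 ((norm z)\<^sup>2)) \<partial>\<nu>)"
        by (intro integral_mono cmod_levy_jump_diff N(1) integrable_norm Bochner_Integration.integrable_diff
            integrable_levy_jump[OF \<nu>] Bochner_Integration.integrable_add integrable_mult_right int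
            integrable_levy_weight[OF \<nu>])
      also have "\<dots> = ((norm h)\<^sup>2 + norm x * norm h + N * norm h) * w
          + 2 * (\<integral>z. indicator {z. norm z > N} z * min 1 ((norm z)\<^sup>2) \<partial>\<nu>)"
        by (subst Bochner_Integration.integral_add)
          (simp_all add: w_def int integrable_levy_weight[OF \<nu>])
      also have "\<dots> \<le> ((norm h)\<^sup>2 + R * norm h + N * norm h) * w + \<epsilon> / 2"
        using N(2) x w0 by (intro add_mono mult_right_mono) auto
      finally show ?thesis .
    qed
    have "levy_exponent D Q \<nu> (x + h) - levy_exponent D Q \<nu> x
      = \<i> * complex_of_real (D \<bullet> h) - complex_of_real ((Q (x + h) \<bullet> (x + h) - Q x \<bullet> x) / 2)
        + ((\<integral>z. levy_jump (x + h) z \<partial>\<nu>) - (\<integral>z. levy_jump x z \<partial>\<nu>))"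
      by (simp add: levy_exponent_def levy_jump_def inner_add_right algebra_simps diff_divide_distrib)
    also have "cmod \<dots> \<le> norm D * norm h + (norm Q * (R * norm h) + norm Q * (norm h)\<^sup>2)
        + (((norm h)\<^sup>2 + R * norm h + N * norm h) * w + \<epsilon> / 2)"
    proof (rule order_trans[OF norm_triangle_ineq add_mono[OF order_trans[OF norm_triangle_ineq4 add_mono] jump]])
      show "cmod (\<i> * complex_of_real (D \<bullet> h)) \<le> norm D * norm h"
        by (simp add: norm_mult Cauchy_Schwarz_ineq2)
      show "cmod (complex_of_real ((Q (x + h) \<bullet> (x + h) - Q x \<bullet> x) / 2))
        \<le> norm Q * (R * norm h) + norm Q * (norm h)\<^sup>2"
        unfolding norm_of_real using quad by simp
    qed
    also have "\<dots> = \<epsilon> / 2 + C1 * norm h + C2 * (norm h)\<^sup>2"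
      by (simp add: C1_def C2_def algebra_simps)
    finally show ?thesis .
  qed
  obtain C3 where C3: "C3 \<ge> 0" "\<forall>y\<ge>0. C1 * y \<le> \<epsilon> / 2 + C3 * y\<^sup>2"
    using young_square[of "\<epsilon> / 2" C1] \<open>\<epsilon> > 0\<close> by auto
  have "cmod (levy_exponent D Q \<nu> (x + h) - levy_exponent D Q \<nu> x)
      \<le> \<epsilon> + (C3 + C2) * (norm h)\<^sup>2" if "norm x \<le> R" for x h
    using main[OF that, of h] C3(2)[rule_format, of "norm h"] by (simp add: algebra_simps)
  moreover have "C3 + C2 \<ge> 0" using C2 C3(1) by simp
  ultimately show ?thesis by blast
qed

text \<open>The increment estimate at one base point. It makes Psi integrable along the continuous
  curve u -> adjoint (S u) x.\<close>

lemma continuous_levy_exponent: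
  fixes D :: "'b::{real_inner,second_countable_topology}"
  assumes "levy_measure \<nu>"
  shows "continuous_on UNIV (levy_exponent D Q \<nu>)"
proof -
  have "isCont (levy_exponent D Q \<nu>) x" for x
    unfolding continuous_at_eps_delta
  proof (intro allI impI)
    fix e :: real assume "e > 0"
    then obtain C where C: "C \<ge> 0" "\<And>y h. norm y \<le> norm x \<Longrightarrow>
        cmod (levy_exponent D Q \<nu> (y + h) - levy_exponent D Q \<nu> y) \<le> e / 2 + C * (norm h)\<^sup>2"
      using levy_exponent_diff[OF assms, of "e / 2" "norm x" D Q] by auto
    \<comment> \<open>d \<le> 1 gives |h|^2 \<le> |h|, so the quadratic term stays below C d < e /
      2; C + 1 keeps the denominator positive when C = 0.\<close>
    define d where "d = min 1 (e / (2 * (C + 1)))"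
    have d: "d > 0" using \<open>e > 0\<close> C(1) by (simp add: d_def)
    have "dist (levy_exponent D Q \<nu> y) (levy_exponent D Q \<nu> x) < e" if y: "dist y x < d" for y
    proof -
      have n: "norm (y - x) < d" using y by (simp add: dist_norm)
      then have "(norm (y - x))\<^sup>2 \<le> norm (y - x)"
        unfolding power2_eq_square by (intro mult_left_le) (auto simp: d_def)
      then have "C * (norm (y - x))\<^sup>2 \<le> C * d"
        using n C(1) by (intro mult_left_mono) auto
      also have "\<dots> \<le> C * (e / (2 * (C + 1)))"
        using C(1) by (intro mult_left_mono) (auto simp: d_def)
      also have "\<dots> < e / 2" using C(1) \<open>e > 0\<close> by (simp add: field_simps)
      finally show ?thesis using C(2)[of x "y - x"] by (simp add: dist_norm)
    qed
    then show "\<exists>d>0. \<forall>y. dist y x < d \<longrightarrow> dist (levy_exponent D Q \<nu> y) (levy_exponent D Q \<nu> x) < e"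
      using d by blast
  qed
  then show ?thesis by (simp add: continuous_on_eq_continuous_at)
qed

lemma levy_exponent_0 [simp]: "levy_exponent D Q \<nu> 0 = 0"
  by (simp add: levy_exponent_def)


section \<open>Characteristic functions of integrals of step functions\<close>

text \<open>Set on an arbitrary separable Hilbert space \<open>'b\<close>, which the theorem takes
  to be the space of Hilbert-Schmidt operators.\<close>

locale levy_triplet = prob_space M
  for M :: "'w measure" and F :: "real \<Rightarrow> 'w measure"
    and L :: "real \<Rightarrow> 'w \<Rightarrow> 'b::{real_inner,banach,second_countable_topology}"
    and D :: 'b and Q :: "'b \<Rightarrow>\<^sub>L 'b" and \<nu> :: "'b measure" +
  assumes filtered: "filtered M F" and levy: "levy_process M F L"
    and triplet: "characteristic_triplet M L D Q \<nu>"
begin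

section \<open>Adaptedness and independent increments\<close>

lemma levy_measure: "levy_measure \<nu>"
  using triplet by (simp add: characteristic_triplet_def)

lemma subalgebra_filtration: "0 \<le> t \<Longrightarrow> subalgebra M (F t)"
  using filtered by (simp add: filtered_def)

lemma measurable_filtration_mono:
  assumes "0 \<le> s" "s \<le> t" "f \<in> measurable (F s) N"
  shows "f \<in> measurable (F t) N"
  using assms filtered
  by (intro measurable_from_subalg[of "F t" "F s"]) (auto simp: filtered_def subalgebra_def)

lemma measurable_filtration: "0 \<le> s \<Longrightarrow> f \<in> measurable (F s) N \<Longrightarrow> f \<in> measurable M N"
  using measurable_from_subalg subalgebra_filtration by blast

lemma levy_adapted: "0 \<le> s \<Longrightarrow> s \<le> t \<Longrightarrow> L s \<in> borel_measurable (F t)"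
  by (rule measurable_filtration_mono[of s]) (use levy in \<open>auto simp: levy_process_def\<close>)

lemma levy_measurable [measurable]: "0 \<le> s \<Longrightarrow> L s \<in> borel_measurable M"
  using levy_adapted[of s s] measurable_filtration by simp

text \<open>Independence splits off V, stationarity replaces the increment by L(b - a), and the
  triplet evaluates it. The factor V will carry both the conditioning event and the exponential of
  the integral up to time a.\<close>

lemma levy_increment_char:
  assumes ab: "0 \<le> a" "a \<le> b" and V: "V \<in> borel_measurable (F a)"
    and bdd: "\<And>\<omega>. cmod (V \<omega>) \<le> B"
  shows "(\<integral>\<omega>. V \<omega> * iexp ((L b \<omega> - L a \<omega>) \<bullet> x) \<partial>M)
    = (\<integral>\<omega>. V \<omega> \<partial>M) * exp (complex_of_real (b - a) * levy_exponent D Q \<nu> x)"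
proof -
  let ?X = "\<lambda>\<omega>. L b \<omega> - L a \<omega>"
  have [measurable]: "L a \<in> borel_measurable M" "L b \<in> borel_measurable M" "V \<in> borel_measurable M"
    using ab V measurable_filtration by (auto intro: levy_measurable)
  have "indep_set (sets (F a)) {?X -` A \<inter> space M | A. A \<in> sets borel}"
    using levy ab by (simp add: levy_process_def)
  moreover have "sigma_sets (space M) {V -` A \<inter> space M | A. A \<in> sets borel} \<subseteq> sets (F a)"
  proof -
    have sp: "space M = space (F a)" using subalgebra_filtration[OF ab(1)] by (simp add: subalgebra_def)
    show ?thesis unfolding sp
      by (rule sets.sigma_sets_subset) (use V in \<open>auto intro: measurable_sets\<close>)
  qed
  \<comment> \<open>Preimages of Borel sets already form a sigma-algebra, and those under a Borel
    function of the increment are preimages under the increment.\<close>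
  moreover have "sigma_sets (space M) {(\<lambda>\<omega>. iexp (?X \<omega> \<bullet> x)) -` A \<inter> space M | A. A \<in> sets borel}
      \<subseteq> {?X -` A \<inter> space M | A. A \<in> sets borel}"
  proof -
    have "sigma_sets (space M) {W -` A \<inter> space M | A. A \<in> sets borel}
        = {W -` A \<inter> space M | A. A \<in> sets borel}" for W :: "'w \<Rightarrow> complex"
      using sets_vimage_algebra[of "space M" W borel] sets_vimage_algebra2[of W "space M" borel] by simp
    moreover have "\<exists>B. (\<lambda>\<omega>. iexp (?X \<omega> \<bullet> x)) -` A \<inter> space M = ?X -` B \<inter> space M \<and> B \<in> sets borel"
      if "A \<in> sets borel" for A
      by (rule exI[of _ "(\<lambda>y. iexp (y \<bullet> x)) -` A"])
        (use that in \<open>auto intro!: borel_measurable_vimage_borel measurable_sets_borel[of _ borel]\<close>)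
    ultimately show ?thesis by auto
  qed
  ultimately have indep: "indep_var borel V borel (\<lambda>\<omega>. iexp (?X \<omega> \<bullet> x))"
    unfolding indep_var_eq indep_set_def
    by (intro conjI; (elim indep_sets_mono_sets)?) (auto split: bool.split)
  have "integrable M V" by (rule integrable_const_bound[of _ B]) (auto simp: bdd)
  moreover have "integrable M (\<lambda>\<omega>. iexp (?X \<omega> \<bullet> x))" by (rule integrable_const_bound[of _ 1]) auto
  ultimately have "(\<integral>\<omega>. V \<omega> * iexp (?X \<omega> \<bullet> x) \<partial>M) = (\<integral>\<omega>. V \<omega> \<partial>M) * (\<integral>\<omega>. iexp (?X \<omega> \<bullet> x) \<partial>M)"
    by (rule indep_var_lebesgue_integral[OF indep])
  \<comment> \<open>Stationarity is an equality of laws, so the integral moves to the image measure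
    and back.\<close>
  also have "(\<integral>\<omega>. iexp (?X \<omega> \<bullet> x) \<partial>M) = (\<integral>y. iexp (y \<bullet> x) \<partial>distr M borel ?X)"
    by (subst integral_distr) auto
  also have "\<dots> = (\<integral>y. iexp (y \<bullet> x) \<partial>distr M borel (L (b - a)))"
    using levy ab by (simp add: levy_process_def)
  also have "\<dots> = (\<integral>\<omega>. iexp (L (b - a) \<omega> \<bullet> x) \<partial>M)"
    by (subst integral_distr) (use ab in \<open>auto intro: levy_measurable\<close>)
  also have "\<dots> = exp (complex_of_real (b - a) * levy_exponent D Q \<nu> x)"
    using triplet ab by (simp add: characteristic_triplet_def)
  finally show ?thesis .
qed

end

text \<open>\<open>Z\<close> is the integral process of the piecewise constant integrand \<open>f\<close> against \<open>L\<close>.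
  Naming only the break points, and not the representation of \<open>f\<close> as a sum of indicators,
  avoids common refinements of partitions in \<open>elementary_diff\<close>.\<close>

definition elementary ::
    "(real \<Rightarrow> 'w \<Rightarrow> 'b::real_inner) \<Rightarrow> (real \<Rightarrow> 'b) \<Rightarrow> (real \<Rightarrow> 'w \<Rightarrow> real) \<Rightarrow> bool" where
  "elementary L f Z \<longleftrightarrow> (\<exists>P. finite P \<and> (\<forall>a b. 0 \<le> a \<and> a < b \<and> P \<inter> {a<..<b} = {} \<longrightarrow>
     (\<forall>u\<in>{a<..b}. f u = f b) \<and> (\<forall>\<omega>. Z b \<omega> - Z a \<omega> = (L b \<omega> - L a \<omega>) \<bullet> f b)))"

text \<open>Strong induction on the number of break points strictly between a and b. It reduces a
  claim about elementary integrals to one increment of L and to additivity over adjacent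
  intervals.\<close>

lemma elementary_induct [consumes 3, case_names refl const trans]:
  assumes el: "elementary L f Z" and ab: "0 \<le> a" "a \<le> b"
    and refl: "\<And>a. 0 \<le> a \<Longrightarrow> R a a"
    and const: "\<And>a b. 0 \<le> a \<Longrightarrow> a < b \<Longrightarrow> (\<And>u. a < u \<Longrightarrow> u \<le> b \<Longrightarrow> f u = f b) \<Longrightarrow>
      (\<And>\<omega>. Z b \<omega> - Z a \<omega> = (L b \<omega> - L a \<omega>) \<bullet> f b) \<Longrightarrow> R a b"
    and trans: "\<And>a c b. 0 \<le> a \<Longrightarrow> a \<le> c \<Longrightarrow> c \<le> b \<Longrightarrow> R a c \<Longrightarrow> R c b \<Longrightarrow> R a b"
  shows "R a b"
proof -
  obtain P where "finite P" and P: "\<forall>a b. 0 \<le> a \<and> a < b \<and> P \<inter> {a<..<b} = {} \<longrightarrow>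
     (\<forall>u\<in>{a<..b}. f u = f b) \<and> (\<forall>\<omega>. Z b \<omega> - Z a \<omega> = (L b \<omega> - L a \<omega>) \<bullet> f b)"
    using el unfolding elementary_def by (elim exE conjE)
  show ?thesis using ab
  proof (induction "card (P \<inter> {a<..<b})" arbitrary: a b rule: less_induct)
    case less
    show ?case
    proof (cases "P \<inter> {a<..<b} = {}")
      case True
      show ?thesis
      proof (cases "a = b")
        case False
        then have "a < b" using less.prems by simp
        then have *: "(\<forall>u\<in>{a<..b}. f u = f b) \<and> (\<forall>\<omega>. Z b \<omega> - Z a \<omega> = (L b \<omega> - L a \<omega>) \<bullet> f b)"
          using less.prems True by (intro P[rule_format]) simp
        show ?thesis by (rule const[OF less.prems(1) \<open>a < b\<close>]) (use * in \<open>blast intro: greaterThanAtMost_iff[THEN iffD2]\<close>)+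
      qed (use refl less.prems in simp)
    next
      case False
      then obtain c where c: "c \<in> P" "a < c" "c < b" by auto
      \<comment> \<open>The cut c is itself a break point and lies in neither open half, so both
        counts drop.\<close>
      have "P \<inter> {a<..<c} \<subset> P \<inter> {a<..<b}" "P \<inter> {c<..<b} \<subset> P \<inter> {a<..<b}" using c by auto
      then have "card (P \<inter> {a<..<c}) < card (P \<inter> {a<..<b})" "card (P \<inter> {c<..<b}) < card (P \<inter> {a<..<b})"
        using \<open>finite P\<close> by (auto intro: psubset_card_mono)
      then show ?thesis
        using less.hyps[of a c] less.hyps[of c b] less.prems c by (intro trans[of a c b]) auto
    qed
  qed
qed

lemma elementary_diff:
  assumes "elementary L f Z" "elementary L g W"
  shows "elementary L (\<lambda>u. f u - g u) (\<lambda>u \<omega>. Z u \<omega> - W u \<omega>)"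
proof -
  obtain P where P: "finite P" "\<forall>a b. 0 \<le> a \<and> a < b \<and> P \<inter> {a<..<b} = {} \<longrightarrow>
     (\<forall>u\<in>{a<..b}. f u = f b) \<and> (\<forall>\<omega>. Z b \<omega> - Z a \<omega> = (L b \<omega> - L a \<omega>) \<bullet> f b)"
    using assms(1) unfolding elementary_def by (elim exE conjE)
  obtain P' where P': "finite P'" "\<forall>a b. 0 \<le> a \<and> a < b \<and> P' \<inter> {a<..<b} = {} \<longrightarrow>
     (\<forall>u\<in>{a<..b}. g u = g b) \<and> (\<forall>\<omega>. W b \<omega> - W a \<omega> = (L b \<omega> - L a \<omega>) \<bullet> g b)"
    using assms(2) unfolding elementary_def by (elim exE conjE)
  show ?thesis
    unfolding elementary_def
  proof (intro exI[of _ "P \<union> P'"] conjI allI impI; (elim conjE)?)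
    fix a b :: real assume ab: "0 \<le> a" "a < b" and "(P \<union> P') \<inter> {a<..<b} = {}"
    then have disj: "P \<inter> {a<..<b} = {}" "P' \<inter> {a<..<b} = {}" by auto
    have f: "(\<forall>u\<in>{a<..b}. f u = f b) \<and> (\<forall>\<omega>. Z b \<omega> - Z a \<omega> = (L b \<omega> - L a \<omega>) \<bullet> f b)"
      using ab disj by (intro P(2)[rule_format]) simp
    have g: "(\<forall>u\<in>{a<..b}. g u = g b) \<and> (\<forall>\<omega>. W b \<omega> - W a \<omega> = (L b \<omega> - L a \<omega>) \<bullet> g b)"
      using ab disj by (intro P'(2)[rule_format]) simp
    show "\<forall>u\<in>{a<..b}. f u - g u = f b - g b"
    proof
      fix u assume u: "u \<in> {a<..b}"
      then have "f u = f b" using f by blast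
      moreover have "g u = g b" using g u by blast
      ultimately show "f u - g u = f b - g b" by (simp only:)
    qed
    fix \<omega>
    have "(Z b \<omega> - W b \<omega>) - (Z a \<omega> - W a \<omega>) = (Z b \<omega> - Z a \<omega>) - (W b \<omega> - W a \<omega>)" by simp
    then show "(Z b \<omega> - W b \<omega>) - (Z a \<omega> - W a \<omega>) = (L b \<omega> - L a \<omega>) \<bullet> (f b - g b)"
      using f[THEN conjunct2, rule_format, of \<omega>] g[THEN conjunct2, rule_format, of \<omega>]
      by (simp add: inner_diff_right)
  qed (use P(1) P'(1) in simp)
qed

lemma partition_bounds:
  assumes "partition t n p" "i \<le> n"
  shows "0 \<le> p i" "p i \<le> t"
proof -
  have *: "p i \<le> p j" if "i \<le> j" "j \<le> n" for i j
    using that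
  proof (induction j rule: dec_induct)
    case (step k)
    then have "p k \<le> p (Suc k)" using assms(1) by (simp add: partition_def)
    then show ?case using step by simp
  qed simp
  show "0 \<le> p i" "p i \<le> t"
    using *[of 0 i] *[of i n] assms by (auto simp: partition_def)
qed

lemma adjoint_step_fun:
  fixes A :: "nat \<Rightarrow> 'a::{real_inner,banach} \<Rightarrow>\<^sub>L 'c::real_inner"
  shows "adjoint (step_fun n p A u) x = (\<Sum>i<n. indicator {p i<..p (Suc i)} u *\<^sub>R adjoint (A i) x)"
  by (simp add: step_fun_def adjoint_blinfun_sum adjoint_blinfun_linear)

text \<open>Stopping the integrator at u yields the integral over (0, u], which turns a single
  random variable into a process in u. The break points are the points of the partition.\<close>

lemma elementary_step_integral:
  fixes A :: "nat \<Rightarrow> 'b::{real_inner,banach} \<Rightarrow>\<^sub>L 'c::real_inner"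
  assumes "partition t n p"
  shows "elementary L (\<lambda>u. adjoint (step_fun n p A u) x)
    (\<lambda>u \<omega>. step_integral (\<lambda>r. L (min u r)) n p A \<omega> \<bullet> x)"
  unfolding elementary_def
proof (intro exI[of _ "p ` {..n}"] conjI allI impI; (elim conjE)?)
  fix a b :: real assume ab: "0 \<le> a" "a < b" "p ` {..n} \<inter> {a<..<b} = {}"
  have out: "p i \<le> a \<or> b \<le> p i" if "i \<le> n" for i
  proof -
    have "p i \<notin> {a<..<b}" using ab(3) that by blast
    then show ?thesis by auto
  qed
  have mono: "p i \<le> p (Suc i)" if "i < n" for i using assms that by (simp add: partition_def)
  have ind: "indicator {p i<..p (Suc i)} u = (indicator {p i<..p (Suc i)} b :: real)"
    if "i < n" "u \<in> {a<..b}" for i u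
    using out[of i] out[of "Suc i"] that by (auto simp: indicator_def)
  have "step_fun n p A u = step_fun n p A b" if u: "u \<in> {a<..b}" for u
    unfolding step_fun_def by (intro sum.cong refl arg_cong2[where f = scaleR] ind[OF _ u]) simp
  then show "\<forall>u\<in>{a<..b}. adjoint (step_fun n p A u) x = adjoint (step_fun n p A b) x" by metis
  fix \<omega>
  have incr: "(L (min b (p (Suc i))) \<omega> - L (min b (p i)) \<omega>) - (L (min a (p (Suc i))) \<omega> - L (min a (p i)) \<omega>)
      = indicator {p i<..p (Suc i)} b *\<^sub>R (L b \<omega> - L a \<omega>)" if i: "i < n" for i
  \<comment> \<open>With no break point inside (a, b), the interval (a, b] lies within the cell,
    after it or before it; outside the cell both stopped increments coincide.\<close>
  proof -
    consider "p i \<le> a" "b \<le> p (Suc i)" | "p (Suc i) \<le> a" | "b \<le> p i"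
      using out[of i] out[of "Suc i"] i by force
    then show ?thesis
      by cases (use mono[OF i] ab(2) in \<open>simp_all add: min_absorb1 min_absorb2\<close>)
  qed
  have "step_integral (\<lambda>r. L (min b r)) n p A \<omega> - step_integral (\<lambda>r. L (min a r)) n p A \<omega>
      = (\<Sum>i<n. indicator {p i<..p (Suc i)} b *\<^sub>R A i (L b \<omega> - L a \<omega>))"
    unfolding step_integral_def sum_subtractf[symmetric] blinfun.diff_right[symmetric]
    by (rule sum.cong) (simp_all add: incr blinfun.scaleR_right del: blinfun.diff_right)
  also have "\<dots> = step_fun n p A b (L b \<omega> - L a \<omega>)"
    by (simp add: step_fun_def blinfun.sum_left blinfun.scaleR_left)
  finally show "step_integral (\<lambda>r. L (min b r)) n p A \<omega> \<bullet> x - step_integral (\<lambda>r. L (min a r)) n p A \<omega> \<bullet> x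
      = (L b \<omega> - L a \<omega>) \<bullet> adjoint (step_fun n p A b) x"
    by (simp only: inner_diff_left[symmetric] blinfun_adjoint[symmetric])
qed simp

text \<open>At time 0 every stopped increment is L 0 - L 0, so the value 0 is exact for every
  \<omega>, although L 0 vanishes only almost everywhere.\<close>

lemma step_integral_stopped:
  assumes "partition t n p"
  shows "step_integral (\<lambda>r. L (min 0 r)) n p A \<omega> = 0"
    and "step_integral (\<lambda>r. L (min t r)) n p A \<omega> = step_integral L n p A \<omega>"
  unfolding step_integral_def
  by (intro sum.neutral sum.cong ballI refl; simp add: partition_bounds[OF assms] min_absorb1 min_absorb2)+

section \<open>Characteristic functions of elementary integrals\<close>

context levy_triplet
begin

lemma elementary_adapted:
  assumes "elementary L f Z" "0 \<le> a" "a \<le> b"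
  shows "(\<lambda>\<omega>. Z b \<omega> - Z a \<omega>) \<in> borel_measurable (F b)"
  using assms
proof (induction rule: elementary_induct)
  case (const a b)
  have [measurable]: "L a \<in> borel_measurable (F b)" "L b \<in> borel_measurable (F b)"
    using const(1,2) by (auto intro: levy_adapted)
  show ?case unfolding const(4) by measurable
next
  case (trans a c b)
  then have [measurable]: "(\<lambda>\<omega>. Z c \<omega> - Z a \<omega>) \<in> borel_measurable (F b)" "(\<lambda>\<omega>. Z b \<omega> - Z c \<omega>) \<in> borel_measurable (F b)"
    using measurable_filtration_mono[of c b] by auto
  have "(\<lambda>\<omega>. (Z c \<omega> - Z a \<omega>) + (Z b \<omega> - Z c \<omega>)) \<in> borel_measurable (F b)" by measurable
  then show ?case by simp
qed simp

text \<open>On (a, b] the integrand takes finitely many values, each on a finite union of intervals,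
  so g may be any function.\<close>

lemma elementary_integrable:
  fixes g :: "'b \<Rightarrow> complex"
  assumes "elementary L f Z" "0 \<le> a" "a \<le> b"
  shows "set_integrable lborel {a<..b} (\<lambda>u. g (f u))"
  using assms
proof (induction rule: elementary_induct)
  case (const a b)
  have "set_integrable lborel {a<..b} (\<lambda>u. g (f b))"
    unfolding set_integrable_def
    by (intro integrable_scaleR_left impI integrable_real_indicator) (use const(2) in auto)
  also have "?this \<longleftrightarrow> ?case"
    by (rule set_integrable_cong) (simp_all, use const(3) in metis)
  finally show ?case .
next
  case (trans a c b)
  then have "set_integrable lborel ({a<..c} \<union> {c<..b}) (\<lambda>u. g (f u))"
    by (intro set_integrable_Un) auto
  also have "{a<..c} \<union> {c<..b} = {a<..b}" using trans by auto
  finally show ?case .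
qed (simp add: set_integrable_def)

text \<open>V is generalised in the induction: the piece over (c, b] is integrated out first, with
  the exponential of the piece over (a, c] absorbed into V.\<close>

lemma elementary_char:
  assumes "elementary L f Z" "0 \<le> a" "a \<le> b"
    and "V \<in> borel_measurable (F a)" "\<And>\<omega>. cmod (V \<omega>) \<le> B"
  shows "(\<integral>\<omega>. V \<omega> * iexp (Z b \<omega> - Z a \<omega>) \<partial>M)
    = (\<integral>\<omega>. V \<omega> \<partial>M) * exp (LINT u:{a<..b}|lborel. levy_exponent D Q \<nu> (f u))"
  using assms
proof (induction arbitrary: V rule: elementary_induct)
  case (refl a)
  then show ?case by (simp add: set_lebesgue_integral_def)
next
  case (const a b)
  have "(LINT u:{a<..b}|lborel. levy_exponent D Q \<nu> (f u)) = (LINT u:{a<..b}|lborel. levy_exponent D Q \<nu> (f b))"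
    by (rule set_lebesgue_integral_cong) (simp, use const(3) in \<open>metis greaterThanAtMost_iff\<close>)
  also have "\<dots> = complex_of_real (b - a) * levy_exponent D Q \<nu> (f b)"
    using const(2) by (simp add: set_integral_const scaleR_conv_of_real)
  finally show ?case
    unfolding const(4) using levy_increment_char[of a b V B "f b"] const(1,2,5,6) by simp
next
  case (trans a c b)
  let ?V = "\<lambda>\<omega>. V \<omega> * iexp (Z c \<omega> - Z a \<omega>)"
  have [measurable]: "V \<in> borel_measurable (F c)" "(\<lambda>\<omega>. Z c \<omega> - Z a \<omega>) \<in> borel_measurable (F c)"
    using trans assms(1) by (auto intro: measurable_filtration_mono elementary_adapted)
  have V: "?V \<in> borel_measurable (F c)" by measurable
  have V_bdd: "cmod (?V \<omega>) \<le> B" for \<omega> using trans by (simp add: norm_mult)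
  have split: "(LINT u:{a<..b}|lborel. levy_exponent D Q \<nu> (f u)) =
      (LINT u:{a<..c}|lborel. levy_exponent D Q \<nu> (f u)) + (LINT u:{c<..b}|lborel. levy_exponent D Q \<nu> (f u))"
  proof -
    have "{a<..b} = {a<..c} \<union> {c<..b}" using trans by auto
    then show ?thesis using trans assms(1)
      by (simp only:) (intro set_integral_Un elementary_integrable; auto)
  qed
  have merge: "V \<omega> * iexp (Z b \<omega> - Z a \<omega>) = ?V \<omega> * iexp (Z b \<omega> - Z c \<omega>)" for \<omega>
    by (simp add: mult.assoc algebra_simps flip: exp_add)
  have "(\<integral>\<omega>. V \<omega> * iexp (Z b \<omega> - Z a \<omega>) \<partial>M)
      = (\<integral>\<omega>. ?V \<omega> \<partial>M) * exp (LINT u:{c<..b}|lborel. levy_exponent D Q \<nu> (f u))"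
    unfolding merge by (rule trans.IH(2)[OF V V_bdd])
  also have "(\<integral>\<omega>. ?V \<omega> \<partial>M) = (\<integral>\<omega>. V \<omega> \<partial>M) * exp (LINT u:{a<..c}|lborel. levy_exponent D Q \<nu> (f u))"
    by (rule trans.IH(1)[OF trans.prems])
  finally show ?case unfolding split by (simp add: exp_add mult.assoc)
qed

end


section \<open>Passage to the limit\<close>

text \<open>The constant is moved to the measurable side g before comparing, so that f may be a norm
  of operators about whose measurability nothing is known.\<close>

lemma nn_integral_le_cmult:
  assumes [measurable]: "g \<in> borel_measurable M" and c: "c > 0"
    and le: "\<And>x. x \<in> space M \<Longrightarrow> g x \<le> ennreal c * f x"
  shows "(\<integral>\<^sup>+ x. g x \<partial>M) \<le> ennreal c * (\<integral>\<^sup>+ x. f x \<partial>M)"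
proof -
  have inv: "ennreal c * (ennreal (1 / c) * y) = y" "ennreal (1 / c) * (ennreal c * y) = y" for y
    using c by (simp_all add: mult.assoc[symmetric] ennreal_mult[symmetric])
  have "(\<integral>\<^sup>+ x. g x \<partial>M) = ennreal c * (\<integral>\<^sup>+ x. ennreal (1 / c) * g x \<partial>M)"
    by (simp add: nn_integral_cmult inv)
  also have "\<dots> \<le> ennreal c * (\<integral>\<^sup>+ x. f x \<partial>M)"
  proof (intro mult_left_mono nn_integral_mono)
    fix x assume "x \<in> space M"
    then show "ennreal (1 / c) * g x \<le> f x"
      using mult_left_mono[OF le, of x "ennreal (1 / c)"] by (simp add: inv)
  qed simp
  finally show ?thesis .
qed

text \<open>The common limit argument behind the bounds \<epsilon> + C h: first \<epsilon> is chosen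
  against the finite mass of w, which fixes C, and then the integral of h k tends to 0.\<close>

lemma nn_integral_tendsto_0:
  fixes g h :: "nat \<Rightarrow> 'a \<Rightarrow> ennreal"
  assumes [measurable]: "\<And>k. h k \<in> borel_measurable M" "w \<in> borel_measurable M"
    and w: "(\<integral>\<^sup>+ x. w x \<partial>M) < \<infinity>"
    and le: "\<And>\<epsilon>. \<epsilon> > 0 \<Longrightarrow> \<exists>C. \<forall>k x. g k x \<le> ennreal \<epsilon> * w x + ennreal C * h k x"
    and lim: "(\<lambda>k. \<integral>\<^sup>+ x. h k x \<partial>M) \<longlonglongrightarrow> 0"
  shows "(\<lambda>k. \<integral>\<^sup>+ x. g k x \<partial>M) \<longlonglongrightarrow> 0"
proof (rule order_tendstoI)
  fix a :: ennreal assume "0 < a"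
  then obtain r where r: "0 < r" "ennreal r < a"
    by (metis dense ennreal_cases ennreal_less_zero_iff less_top_ennreal order_less_le_trans top_greatest)
  obtain W where W: "W \<ge> 0" "(\<integral>\<^sup>+ x. w x \<partial>M) = ennreal W"
    using w by (cases "\<integral>\<^sup>+ x. w x \<partial>M") auto
  \<comment> \<open>W may be 0, hence the denominator W + 1.\<close>
  define \<epsilon> where "\<epsilon> = r / (W + 1)"
  have \<epsilon>: "\<epsilon> > 0" "\<epsilon> * W \<le> r" using r W by (simp_all add: \<epsilon>_def field_simps)
  obtain C where C: "\<And>k x. g k x \<le> ennreal \<epsilon> * w x + ennreal C * h k x" using le[OF \<epsilon>(1)] by blast
  have bound: "(\<integral>\<^sup>+ x. g k x \<partial>M) \<le> ennreal (\<epsilon> * W) + ennreal C * (\<integral>\<^sup>+ x. h k x \<partial>M)" for k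
  proof -
    have "(\<integral>\<^sup>+ x. g k x \<partial>M) \<le> (\<integral>\<^sup>+ x. ennreal \<epsilon> * w x + ennreal C * h k x \<partial>M)"
      by (intro nn_integral_mono C)
    also have "\<dots> = ennreal \<epsilon> * (\<integral>\<^sup>+ x. w x \<partial>M) + ennreal C * (\<integral>\<^sup>+ x. h k x \<partial>M)"
      by (simp add: nn_integral_add nn_integral_cmult)
    finally show ?thesis using W \<epsilon> by (simp add: ennreal_mult)
  qed
  have "(\<lambda>k. ennreal (\<epsilon> * W) + ennreal C * (\<integral>\<^sup>+ x. h k x \<partial>M)) \<longlonglongrightarrow> ennreal (\<epsilon> * W) + ennreal C * 0"
    by (intro tendsto_add tendsto_const ennreal_tendsto_cmult lim) simp
  moreover have "ennreal (\<epsilon> * W) + ennreal C * 0 < a"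
    using \<epsilon>(2) r(2) ennreal_leI[of "\<epsilon> * W" r] by simp
  ultimately have "\<forall>\<^sub>F k in sequentially. ennreal (\<epsilon> * W) + ennreal C * (\<integral>\<^sup>+ x. h k x \<partial>M) < a"
    by (rule order_tendstoD)
  then show "\<forall>\<^sub>F k in sequentially. (\<integral>\<^sup>+ x. g k x \<partial>M) < a"
    by eventually_elim (rule le_less_trans[OF bound])
qed simp

text \<open>Carries L2 convergence of operator integrands, measured in operator norm, over to the
  vector integrands obtained by testing against x.\<close>

lemma set_nn_integral_adjoint_tendsto_0:
  fixes \<Phi> :: "nat \<Rightarrow> real \<Rightarrow> 'a::{real_inner,banach,second_countable_topology} \<Rightarrow>\<^sub>L 'c::real_inner"
  assumes lim: "(\<lambda>k. \<integral>\<^sup>+ u\<in>S. ennreal ((norm (\<Phi> k u - \<Psi> u))\<^sup>2) \<partial>M) \<longlonglongrightarrow> 0"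
    and [measurable]: "\<And>k. (\<lambda>u. adjoint (\<Phi> k u) x) \<in> borel_measurable M"
      "(\<lambda>u. adjoint (\<Psi> u) x) \<in> borel_measurable M" "S \<in> sets M"
  shows "(\<lambda>k. \<integral>\<^sup>+ u\<in>S. ennreal ((norm (adjoint (\<Phi> k u) x - adjoint (\<Psi> u) x))\<^sup>2) \<partial>M) \<longlonglongrightarrow> 0"
proof (rule tendsto_sandwich[OF _ _ tendsto_const])
  \<comment> \<open>The added 1 makes the constant strictly positive even for x = 0.\<close>
  let ?c = "(norm x)\<^sup>2 + 1"
  have "(\<lambda>k. ennreal ?c * (\<integral>\<^sup>+ u\<in>S. ennreal ((norm (\<Phi> k u - \<Psi> u))\<^sup>2) \<partial>M)) \<longlonglongrightarrow> ennreal ?c * 0"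
    by (intro ennreal_tendsto_cmult lim) simp
  then show "(\<lambda>k. ennreal ?c * (\<integral>\<^sup>+ u\<in>S. ennreal ((norm (\<Phi> k u - \<Psi> u))\<^sup>2) \<partial>M)) \<longlonglongrightarrow> 0" by simp
  show "\<forall>\<^sub>F k in sequentially. (\<integral>\<^sup>+ u\<in>S. ennreal ((norm (adjoint (\<Phi> k u) x - adjoint (\<Psi> u) x))\<^sup>2) \<partial>M)
      \<le> ennreal ?c * (\<integral>\<^sup>+ u\<in>S. ennreal ((norm (\<Phi> k u - \<Psi> u))\<^sup>2) \<partial>M)"
  proof (intro always_eventually allI nn_integral_le_cmult)
    fix k u
    have "norm (adjoint (\<Phi> k u) x - adjoint (\<Psi> u) x) \<le> norm (\<Phi> k u - \<Psi> u) * norm x"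
      using norm_adjoint_blinfun_le[of "\<Phi> k u - \<Psi> u" x] by (simp add: adjoint_blinfun_linear)
    then have "(norm (adjoint (\<Phi> k u) x - adjoint (\<Psi> u) x))\<^sup>2 \<le> (norm (\<Phi> k u - \<Psi> u) * norm x)\<^sup>2"
      by (intro power_mono) auto
    also have "\<dots> \<le> ?c * (norm (\<Phi> k u - \<Psi> u))\<^sup>2" by (simp add: power_mult_distrib algebra_simps)
    finally have "ennreal ((norm (adjoint (\<Phi> k u) x - adjoint (\<Psi> u) x))\<^sup>2)
        \<le> ennreal ?c * ennreal ((norm (\<Phi> k u - \<Psi> u))\<^sup>2)"
      by (subst ennreal_mult[symmetric]) (auto intro: ennreal_leI)
    then show "ennreal ((norm (adjoint (\<Phi> k u) x - adjoint (\<Psi> u) x))\<^sup>2) * indicator S u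
        \<le> ennreal ?c * (ennreal ((norm (\<Phi> k u - \<Psi> u))\<^sup>2) * indicator S u)"
      by (auto simp: indicator_def)
  next
    show "0 < ?c" by (simp add: add_nonneg_pos)
  qed measurable
qed simp

text \<open>Expansion around the limit z: the bound R is required of z alone, while the
  approximations y k may be unbounded.\<close>

lemma levy_exponent_integral_tendsto:
  fixes D :: "'b::{real_inner,banach,second_countable_topology}" and a b :: real
  assumes \<nu>: "levy_measure \<nu>"
    and [measurable]: "\<And>k. y k \<in> borel_measurable borel" "z \<in> borel_measurable borel"
    and bdd: "\<And>u. u \<in> {a<..b} \<Longrightarrow> norm (z u) \<le> R" and R: "R \<ge> 0"
    and int: "\<And>k. set_integrable lborel {a<..b} (\<lambda>u. levy_exponent D Q \<nu> (y k u))"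
      "set_integrable lborel {a<..b} (\<lambda>u. levy_exponent D Q \<nu> (z u))"
    and lim: "(\<lambda>k. \<integral>\<^sup>+ u\<in>{a<..b}. ennreal ((norm (y k u - z u))\<^sup>2) \<partial>lborel) \<longlonglongrightarrow> 0"
  shows "(\<lambda>k. LINT u:{a<..b}|lborel. levy_exponent D Q \<nu> (y k u))
    \<longlonglongrightarrow> (LINT u:{a<..b}|lborel. levy_exponent D Q \<nu> (z u))"
  unfolding set_lebesgue_integral_def
proof (rule tendsto_L1_int)
  show "(\<lambda>k. \<integral>\<^sup>+ u. ennreal (norm (indicator {a<..b} u *\<^sub>R levy_exponent D Q \<nu> (y k u)
      - indicator {a<..b} u *\<^sub>R levy_exponent D Q \<nu> (z u))) \<partial>lborel) \<longlonglongrightarrow> 0"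
  proof (rule nn_integral_tendsto_0[OF _ _ _ _ lim])
    have "(\<integral>\<^sup>+ u. indicator {a<..b} u \<partial>lborel) = emeasure lborel {a<..b}"
      by (rule nn_integral_indicator) simp
    also have "\<dots> < \<infinity>" by (cases "a \<le> b") simp_all
    finally show "(\<integral>\<^sup>+ u. indicator {a<..b} u \<partial>lborel) < \<infinity>" .
    fix \<epsilon> :: real assume "\<epsilon> > 0"
    then obtain C where C: "C \<ge> 0" "\<forall>x h. norm x \<le> R \<longrightarrow>
        cmod (levy_exponent D Q \<nu> (x + h) - levy_exponent D Q \<nu> x) \<le> \<epsilon> + C * (norm h)\<^sup>2"
      using levy_exponent_diff[OF \<nu> _ R] by blast
    have "ennreal (norm (indicator {a<..b} u *\<^sub>R levy_exponent D Q \<nu> (y k u)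
          - indicator {a<..b} u *\<^sub>R levy_exponent D Q \<nu> (z u)))
        \<le> ennreal \<epsilon> * indicator {a<..b} u + ennreal C * (ennreal ((norm (y k u - z u))\<^sup>2) * indicator {a<..b} u)"
      for k u
    proof (cases "u \<in> {a<..b}")
      case True
      have "cmod (levy_exponent D Q \<nu> (z u + (y k u - z u)) - levy_exponent D Q \<nu> (z u))
          \<le> \<epsilon> + C * (norm (y k u - z u))\<^sup>2"
        using C(2) bdd[OF True] by blast
      then have "ennreal (cmod (levy_exponent D Q \<nu> (y k u) - levy_exponent D Q \<nu> (z u)))
          \<le> ennreal \<epsilon> + ennreal C * ennreal ((norm (y k u - z u))\<^sup>2)"
        using C(1) \<open>\<epsilon> > 0\<close> by (simp add: ennreal_mult[symmetric] ennreal_plus[symmetric] ennreal_leI del: ennreal_plus)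
      then show ?thesis using True by simp
    qed simp
    then show "\<exists>C. \<forall>k u. ennreal (norm (indicator {a<..b} u *\<^sub>R levy_exponent D Q \<nu> (y k u)
          - indicator {a<..b} u *\<^sub>R levy_exponent D Q \<nu> (z u)))
        \<le> ennreal \<epsilon> * indicator {a<..b} u + ennreal C * (ennreal ((norm (y k u - z u))\<^sup>2) * indicator {a<..b} u)"
      by blast
  qed measurable
qed (use int in \<open>auto simp: set_integrable_def\<close>)

text \<open>The exponential is Lipschitz, and Young's inequality reduces the first power of the
  distance to its square. The shift c makes room for the deterministic initial term of the mild
  solution.\<close>

lemma (in prob_space) iexp_inner_L1:
  fixes X :: "nat \<Rightarrow> 'a \<Rightarrow> 'b::{real_inner,second_countable_topology}"
  assumes [measurable]: "\<And>k. X k \<in> borel_measurable M" "I \<in> borel_measurable M"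
    and lim: "(\<lambda>k. \<integral>\<^sup>+ \<omega>. ennreal ((norm (X k \<omega> - I \<omega>))\<^sup>2) \<partial>M) \<longlonglongrightarrow> 0"
  shows "(\<lambda>k. \<integral>\<^sup>+ \<omega>. ennreal (cmod (iexp (c + X k \<omega> \<bullet> x) - iexp (c + I \<omega> \<bullet> x))) \<partial>M) \<longlonglongrightarrow> 0"
proof (rule nn_integral_tendsto_0[where w = "\<lambda>_. 1", OF _ _ _ _ lim])
  fix \<epsilon> :: real assume "\<epsilon> > 0"
  then obtain C where C: "C \<ge> 0" "\<forall>y\<ge>0. norm x * y \<le> \<epsilon> + C * y\<^sup>2" using young_square by blast
  have "ennreal (cmod (iexp (c + X k \<omega> \<bullet> x) - iexp (c + I \<omega> \<bullet> x)))
      \<le> ennreal \<epsilon> * 1 + ennreal C * ennreal ((norm (X k \<omega> - I \<omega>))\<^sup>2)" for k \<omega>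
  proof -
    have "cmod (iexp (c + X k \<omega> \<bullet> x) - iexp (c + I \<omega> \<bullet> x)) \<le> \<bar>(X k \<omega> - I \<omega>) \<bullet> x\<bar>"
      using cmod_iexp_diff[of "c + X k \<omega> \<bullet> x" "c + I \<omega> \<bullet> x"] by (simp add: inner_diff_left)
    also have "\<dots> \<le> norm x * norm (X k \<omega> - I \<omega>)"
      using Cauchy_Schwarz_ineq2[of "X k \<omega> - I \<omega>" x] by (simp add: mult.commute)
    also have "\<dots> \<le> \<epsilon> + C * (norm (X k \<omega> - I \<omega>))\<^sup>2" using C(2) by simp
    finally show ?thesis
      using C(1) \<open>\<epsilon> > 0\<close> by (simp add: ennreal_mult[symmetric] ennreal_plus[symmetric] ennreal_leI del: ennreal_plus)
  qed
  then show "\<exists>C. \<forall>k \<omega>. ennreal (cmod (iexp (c + X k \<omega> \<bullet> x) - iexp (c + I \<omega> \<bullet> x)))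
      \<le> ennreal \<epsilon> * 1 + ennreal C * ennreal ((norm (X k \<omega> - I \<omega>))\<^sup>2)" by blast
qed (simp_all add: emeasure_space_1)

text \<open>Since \<open>cmod (iexp U - 1)\<^sup>2 = 2 * Re (1 - iexp U)\<close>, the characteristic functions
  at the single point 1 suffice.\<close>

lemma (in prob_space) iexp_tendsto_1_L1:
  fixes U :: "nat \<Rightarrow> 'a \<Rightarrow> real"
  assumes [measurable]: "\<And>k. U k \<in> borel_measurable M"
    and lim: "(\<lambda>k. \<integral>\<omega>. iexp (U k \<omega>) \<partial>M) \<longlonglongrightarrow> 1"
  shows "(\<lambda>k. \<integral>\<^sup>+ \<omega>. ennreal (cmod (iexp (U k \<omega>) - 1)) \<partial>M) \<longlonglongrightarrow> 0"
proof (rule nn_integral_tendsto_0[where w = "\<lambda>_. 1" and h = "\<lambda>k \<omega>. ennreal ((cmod (iexp (U k \<omega>) - 1))\<^sup>2)"])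
  have int: "integrable M (\<lambda>\<omega>. iexp (U k \<omega>))" for k by (rule integrable_const_bound[of _ 1]) auto
  have sq: "(cmod (iexp r - 1))\<^sup>2 = 2 * Re (1 - iexp r)" for r
  proof -
    have "(cmod (iexp r - 1))\<^sup>2 = (cos r - 1)\<^sup>2 + (sin r)\<^sup>2"
      by (simp add: cmod_power2 Re_exp Im_exp)
    also have "\<dots> = (sin r)\<^sup>2 + (cos r)\<^sup>2 + 1 - 2 * cos r" by (simp add: power2_diff)
    finally show ?thesis by (simp add: Re_exp)
  qed
  have "(\<integral>\<^sup>+ \<omega>. ennreal ((cmod (iexp (U k \<omega>) - 1))\<^sup>2) \<partial>M) = ennreal (2 * Re (1 - (\<integral>\<omega>. iexp (U k \<omega>) \<partial>M)))" for k
  proof -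
    have "(\<integral>\<^sup>+ \<omega>. ennreal ((cmod (iexp (U k \<omega>) - 1))\<^sup>2) \<partial>M) = ennreal (\<integral>\<omega>. (cmod (iexp (U k \<omega>) - 1))\<^sup>2 \<partial>M)"
    proof (rule nn_integral_eq_integral)
      show "integrable M (\<lambda>\<omega>. (cmod (iexp (U k \<omega>) - 1))\<^sup>2)"
        unfolding sq using int by simp
    qed simp
    also have "(\<integral>\<omega>. (cmod (iexp (U k \<omega>) - 1))\<^sup>2 \<partial>M) = (\<integral>\<omega>. 2 * Re (1 - iexp (U k \<omega>)) \<partial>M)"
      by (simp only: sq)
    also have "\<dots> = 2 * Re (\<integral>\<omega>. 1 - iexp (U k \<omega>) \<partial>M)"
      using int by (subst integral_mult_right_zero, subst integral_Re) auto
    also have "(\<integral>\<omega>. 1 - iexp (U k \<omega>) \<partial>M) = 1 - (\<integral>\<omega>. iexp (U k \<omega>) \<partial>M)"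
      using int by (subst Bochner_Integration.integral_diff) (auto simp: prob_space)
    finally show ?thesis .
  qed
  moreover have "(\<lambda>k. ennreal (2 * Re (1 - (\<integral>\<omega>. iexp (U k \<omega>) \<partial>M)))) \<longlonglongrightarrow> ennreal (2 * Re (1 - 1))"
    by (intro tendsto_intros lim)
  ultimately show "(\<lambda>k. \<integral>\<^sup>+ \<omega>. ennreal ((cmod (iexp (U k \<omega>) - 1))\<^sup>2) \<partial>M) \<longlonglongrightarrow> 0" by simp
next
  fix \<epsilon> :: real assume "\<epsilon> > 0"
  \<comment> \<open>Back from the squared distance, which the characteristic function controls, to
    the first power.\<close>
  then obtain C where C: "C \<ge> 0" "\<forall>y\<ge>0. 1 * y \<le> \<epsilon> + C * y\<^sup>2" using young_square by blast
  have "ennreal (cmod (iexp (U k \<omega>) - 1)) \<le> ennreal \<epsilon> * 1 + ennreal C * ennreal ((cmod (iexp (U k \<omega>) - 1))\<^sup>2)" for k \<omega>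
    using C \<open>\<epsilon> > 0\<close> by (simp add: ennreal_mult[symmetric] ennreal_plus[symmetric] ennreal_leI del: ennreal_plus)
  then show "\<exists>C. \<forall>k \<omega>. ennreal (cmod (iexp (U k \<omega>) - 1))
      \<le> ennreal \<epsilon> * 1 + ennreal C * ennreal ((cmod (iexp (U k \<omega>) - 1))\<^sup>2)" by blast
qed (simp_all add: emeasure_space_1)

text \<open>The candidate g is only almost everywhere equal to the F-measurable g', because the
  exponential of Y(s) is known to be F_s-measurable only up to null sets. Real and imaginary parts
  are then characterised separately.\<close>

lemma (in sigma_finite_subalgebra) complex_cond_exp_charact:
  assumes int: "integrable M X" "integrable M g" and g': "g' \<in> borel_measurable F" "AE \<omega> in M. g \<omega> = g' \<omega>"
    and eq: "\<And>A. A \<in> sets F \<Longrightarrow> (\<integral>\<omega>. indicator A \<omega> * X \<omega> \<partial>M) = (\<integral>\<omega>. indicator A \<omega> * g \<omega> \<partial>M)"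
  shows "AE \<omega> in M. complex_cond_exp M F X \<omega> = g \<omega>"
proof -
  have [measurable]: "g' \<in> borel_measurable M" "g \<in> borel_measurable M" "g' \<in> borel_measurable F"
    using g' int measurable_from_subalg[OF subalg] by auto
  have int': "integrable M g'"
    by (rule integrable_cong_AE[THEN iffD1, OF _ _ g'(2) int(2)]) measurable
  have intA: "integrable M (\<lambda>\<omega>. indicator A \<omega> * f \<omega>)" if "A \<in> sets F" "integrable M f" for A and f :: "'a \<Rightarrow> complex"
  proof -
    have "A \<in> sets M" using that subalg by (auto simp: subalgebra_def)
    from integrable_mult_indicator[OF this that(2)] show ?thesis
      by (simp add: scaleR_conv_of_real indicator_def of_bool_def if_distrib if_distribR cong: if_cong)
  qed
  have eq': "(\<integral>\<omega>. indicator A \<omega> * X \<omega> \<partial>M) = (\<integral>\<omega>. indicator A \<omega> * g' \<omega> \<partial>M)" if A: "A \<in> sets F" for A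
  proof -
    have [measurable]: "A \<in> sets M" using A subalg by (auto simp: subalgebra_def)
    have "(\<integral>\<omega>. indicator A \<omega> * g \<omega> \<partial>M) = (\<integral>\<omega>. indicator A \<omega> * g' \<omega> \<partial>M)"
      by (rule integral_cong_AE) (use g'(2) in auto)
    with eq[OF A] show ?thesis by simp
  qed
  have Re: "Re (\<integral>\<omega>. indicator A \<omega> * f \<omega> \<partial>M) = (\<integral>\<omega>\<in>A. Re (f \<omega>) \<partial>M)"
    and Im: "Im (\<integral>\<omega>. indicator A \<omega> * f \<omega> \<partial>M) = (\<integral>\<omega>\<in>A. Im (f \<omega>) \<partial>M)"
    if "A \<in> sets F" "integrable M f" for A and f :: "'a \<Rightarrow> complex"
    using intA[OF that]
    by (auto simp: set_lebesgue_integral_def integral_Re[symmetric] integral_Im[symmetric] indicator_def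
        simp del: integral_Re integral_Im intro!: Bochner_Integration.integral_cong)
  have "AE \<omega> in M. real_cond_exp M F (\<lambda>\<omega>. Re (X \<omega>)) \<omega> = Re (g' \<omega>)"
    by (rule real_cond_exp_charact) (use int int' eq' Re[symmetric] in auto)
  moreover have "AE \<omega> in M. real_cond_exp M F (\<lambda>\<omega>. Im (X \<omega>)) \<omega> = Im (g' \<omega>)"
    by (rule real_cond_exp_charact) (use int int' eq' Im[symmetric] in auto)
  ultimately show ?thesis
    using g'(2) by eventually_elim (simp add: complex_cond_exp_def complex_eq_iff)
qed


section \<open>The mild solution\<close>

lemma borel_measurable_adjoint_step_fun:
  fixes A :: "nat \<Rightarrow> 'a::{real_inner,banach,second_countable_topology} \<Rightarrow>\<^sub>L 'c::real_inner"
  shows "(\<lambda>u. adjoint (step_fun n p A u) x) \<in> borel_measurable borel"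
  unfolding adjoint_step_fun by measurable

lemma set_integral_reflect:
  fixes f :: "real \<Rightarrow> complex"
  assumes [measurable]: "f \<in> borel_measurable borel"
  shows "(LINT u:{s<..t}|lborel. f (t - u)) = (LINT u:{0..t - s}|lborel. f u)"
proof -
  have "(LINT u:{s<..t}|lborel. f (t - u))
      = (\<integral>u. indicator {s<..t} (t + (-1) * u) *\<^sub>R f (t - (t + (-1) * u)) \<partial>lborel)"
    unfolding set_lebesgue_integral_def by (subst lborel_integral_real_affine[where c = "-1" and t = t]) simp_all
  also have "\<dots> = (LINT u:{0..t - s}|lborel. f u)"
    unfolding set_lebesgue_integral_def
  proof (rule integral_cong_AE)
    \<comment> \<open>Reflection maps (s, t] onto [0, t - s), so only the point t - s has to be
      discarded.\<close>
    show "AE u in lborel. indicator {s<..t} (t + (-1) * u) *\<^sub>R f (t - (t + (-1) * u)) = indicator {0..t - s} u *\<^sub>R f u"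
      using AE_lborel_singleton[of "t - s"] by eventually_elim (auto simp: indicator_def)
  qed measurable
  finally show ?thesis .
qed

section \<open>The conditional characteristic function of the mild solution\<close>

context levy_triplet
begin

lemma step_integral_measurable:
  fixes A :: "nat \<Rightarrow> 'b \<Rightarrow>\<^sub>L 'b"
  assumes "partition t n p"
  shows "step_integral L n p A \<in> borel_measurable M"
proof -
  have L_meas: "L (p i) \<in> borel_measurable M" if "i \<le> n" for i
    using partition_bounds[OF assms that] by (intro levy_measurable)
  have [measurable]: "blinfun_apply (A i) \<in> borel_measurable borel" for i
    by (intro borel_measurable_continuous_onI linear_continuous_on blinfun.bounded_linear_right)
  have "(\<lambda>\<omega>. A i (L (p (Suc i)) \<omega> - L (p i) \<omega>)) \<in> borel_measurable M" if "i < n" for i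
  proof -
    have [measurable]: "L (p i) \<in> borel_measurable M" "L (p (Suc i)) \<in> borel_measurable M"
      using that L_meas by simp_all
    show ?thesis by measurable
  qed
  then show ?thesis unfolding step_integral_def[abs_def] by (intro borel_measurable_sum) auto
qed

lemma mild_solution_char:
  fixes Y :: "real \<Rightarrow> 'w \<Rightarrow> 'b" and C :: "'b \<Rightarrow>\<^sub>L 'b" and x :: 'b
  assumes mild: "mild_solution M C L Y0 Y" and st: "0 \<le> s" "s \<le> t"
  shows "AE \<omega> in M. complex_cond_exp M (F s) (\<lambda>\<omega>. iexp (Y t \<omega> \<bullet> x)) \<omega> =
    exp (\<i> * complex_of_real (Y s \<omega> \<bullet> adjoint (op_exp ((t - s) *\<^sub>R C)) x) +
         (LINT u:{0..t - s}|lborel. levy_exponent D Q \<nu> (adjoint (op_exp (u *\<^sub>R C)) x)))"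
proof -
  let ?\<psi> = "levy_exponent D Q \<nu>"
  define x' where "x' = adjoint (op_exp ((t - s) *\<^sub>R C)) x"
  define \<phi> where "\<phi> u = adjoint (op_exp ((t - u) *\<^sub>R C)) x" for u
  \<comment> \<open>Semigroup law on the adjoint side: the integral up to s, tested against x', and
    the integral up to t, tested against x, have the same integrand on (0, s].\<close>
  have \<phi>: "adjoint (op_exp ((s - u) *\<^sub>R C)) x' = \<phi> u" for u
    using op_exp_add[of "t - s" "s - u" C] by (simp add: \<phi>_def x'_def adjoint_blinfun_compose)
  have \<phi>_cont: "continuous_on UNIV \<phi>"
    unfolding \<phi>_def
    by (rule continuous_on_compose2[OF continuous_adjoint_op_exp]) (auto intro!: continuous_intros)
  then have [measurable]: "\<phi> \<in> borel_measurable borel" by (rule borel_measurable_continuous_onI)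
  have t: "0 \<le> t" using st by simp

  obtain I where "has_stochastic_integral M L t (\<lambda>s. op_exp ((t - s) *\<^sub>R C)) I"
    and Yt: "AE \<omega> in M. Y t \<omega> = op_exp (t *\<^sub>R C) Y0 + I \<omega>"
    using mild t unfolding mild_solution_def by blast
  then obtain n p A where I [measurable]: "I \<in> borel_measurable M"
    and p: "\<And>k. partition t (n k) (p k)"
    and A: "(\<lambda>k. \<integral>\<^sup>+ u\<in>{0..t}. ennreal ((norm (step_fun (n k) (p k) (A k) u - op_exp ((t - u) *\<^sub>R C)))\<^sup>2) \<partial>lborel)
          \<longlonglongrightarrow> 0"
    and AI: "(\<lambda>k. \<integral>\<^sup>+ \<omega>. ennreal ((norm (step_integral L (n k) (p k) (A k) \<omega> - I \<omega>))\<^sup>2) \<partial>M) \<longlonglongrightarrow> 0"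
    unfolding has_stochastic_integral_def by blast
  obtain J where "has_stochastic_integral M L s (\<lambda>u. op_exp ((s - u) *\<^sub>R C)) J"
    and Ys: "AE \<omega> in M. Y s \<omega> = op_exp (s *\<^sub>R C) Y0 + J \<omega>"
    using mild st unfolding mild_solution_def by blast
  then obtain m q B where J [measurable]: "J \<in> borel_measurable M"
    and q: "\<And>k. partition s (m k) (q k)"
    and B: "(\<lambda>k. \<integral>\<^sup>+ u\<in>{0..s}. ennreal ((norm (step_fun (m k) (q k) (B k) u - op_exp ((s - u) *\<^sub>R C)))\<^sup>2) \<partial>lborel)
          \<longlonglongrightarrow> 0"
    and BJ: "(\<lambda>k. \<integral>\<^sup>+ \<omega>. ennreal ((norm (step_integral L (m k) (q k) (B k) \<omega> - J \<omega>))\<^sup>2) \<partial>M) \<longlonglongrightarrow> 0"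
    unfolding has_stochastic_integral_def by blast
  have Y_meas [measurable]: "Y t \<in> borel_measurable M" "Y s \<in> borel_measurable M"
    using mild st t by (auto simp: mild_solution_def)

  \<comment> \<open>Tested against one vector, the operator integrals become elementary scalar
    processes: Z for time t and x, W for time s and x'.\<close>
  define f where "f k u = adjoint (step_fun (n k) (p k) (A k) u) x" for k u
  define Z where "Z k u \<omega> = step_integral (\<lambda>r. L (min u r)) (n k) (p k) (A k) \<omega> \<bullet> x" for k u \<omega>
  define g where "g k u = adjoint (step_fun (m k) (q k) (B k) u) x'" for k u
  define W where "W k u \<omega> = step_integral (\<lambda>r. L (min u r)) (m k) (q k) (B k) \<omega> \<bullet> x'" for k u \<omega>
  have elZ: "elementary L (f k) (Z k)" and elW: "elementary L (g k) (W k)" for k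
    unfolding f_def[abs_def] Z_def[abs_def] g_def[abs_def] W_def[abs_def]
    using elementary_step_integral p q by blast+
  have Z0: "Z k 0 \<omega> = 0" and Zt: "Z k t \<omega> = step_integral L (n k) (p k) (A k) \<omega> \<bullet> x"
    and W0: "W k 0 \<omega> = 0" and Ws: "W k s \<omega> = step_integral L (m k) (q k) (B k) \<omega> \<bullet> x'" for k \<omega>
    by (simp_all add: Z_def W_def step_integral_stopped[OF p] step_integral_stopped[OF q])
  have [measurable]: "f k \<in> borel_measurable borel" "g k \<in> borel_measurable borel" for k
    unfolding f_def[abs_def] g_def[abs_def] by (rule borel_measurable_adjoint_step_fun)+

  have limf: "(\<lambda>k. \<integral>\<^sup>+ u\<in>{0..t}. ennreal ((norm (f k u - \<phi> u))\<^sup>2) \<partial>lborel) \<longlonglongrightarrow> 0"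
    using set_nn_integral_adjoint_tendsto_0[OF A, of x] unfolding f_def[symmetric] \<phi>_def[symmetric] by simp
  have limg: "(\<lambda>k. \<integral>\<^sup>+ u\<in>{0..s}. ennreal ((norm (g k u - \<phi> u))\<^sup>2) \<partial>lborel) \<longlonglongrightarrow> 0"
    using set_nn_integral_adjoint_tendsto_0[OF B, of x'] unfolding g_def[symmetric] \<phi> by simp

  obtain R where R: "R > 0" "\<And>u. u \<in> {s<..t} \<Longrightarrow> norm (\<phi> u) \<le> R"
  proof -
    have "bounded (\<phi> ` {s..t})"
      using \<phi>_cont by (intro compact_imp_bounded compact_continuous_image) (auto intro: continuous_on_subset)
    then obtain R where "R > 0" "\<forall>y\<in>\<phi> ` {s..t}. norm y \<le> R" by (auto simp: bounded_pos)
    then show ?thesis by (intro that[of R]) auto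
  qed
  have \<psi>\<phi>_int: "set_integrable lborel {s<..t} (\<lambda>u. ?\<psi> (\<phi> u))"
  proof (rule set_integrable_subset)
    show "set_integrable lborel {s..t} (\<lambda>u. ?\<psi> (\<phi> u))"
      by (intro borel_integrable_atLeastAtMost' continuous_on_compose2[OF continuous_levy_exponent[OF levy_measure]]
          continuous_on_subset[OF \<phi>_cont]) auto
  qed auto
  define K where "K = (LINT u:{s<..t}|lborel. ?\<psi> (\<phi> u))"
  have limK: "(\<lambda>k. LINT u:{s<..t}|lborel. ?\<psi> (f k u)) \<longlonglongrightarrow> K"
    unfolding K_def
  proof (rule levy_exponent_integral_tendsto[OF levy_measure _ _ R(2) _ _ \<psi>\<phi>_int])
    show "(\<lambda>k. \<integral>\<^sup>+ u\<in>{s<..t}. ennreal ((norm (f k u - \<phi> u))\<^sup>2) \<partial>lborel) \<longlonglongrightarrow> 0"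
    proof (rule tendsto_sandwich[OF _ _ tendsto_const limf])
      show "\<forall>\<^sub>F k in sequentially. (\<integral>\<^sup>+ u\<in>{s<..t}. ennreal ((norm (f k u - \<phi> u))\<^sup>2) \<partial>lborel)
          \<le> (\<integral>\<^sup>+ u\<in>{0..t}. ennreal ((norm (f k u - \<phi> u))\<^sup>2) \<partial>lborel)"
        using st by (intro always_eventually allI nn_integral_mono) (auto simp: indicator_def)
    qed simp
  qed (use R(1) elementary_integrable[OF elZ st] in auto)

  \<comment> \<open>Both f k and g k tend to \<phi> in L2 over (0, s], so their difference tends to
    the constant 0, for which R = 0 is a bound.\<close>
  have limU: "(\<lambda>k. LINT u:{0<..s}|lborel. ?\<psi> (f k u - g k u)) \<longlonglongrightarrow> (LINT u:{0<..s}|lborel. ?\<psi> 0)"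
  proof (rule levy_exponent_integral_tendsto[OF levy_measure, where R = 0])
    show "(\<lambda>k. \<integral>\<^sup>+ u\<in>{0<..s}. ennreal ((norm (f k u - g k u - 0))\<^sup>2) \<partial>lborel) \<longlonglongrightarrow> 0"
    proof (rule tendsto_sandwich[OF _ _ tendsto_const])
      let ?F = "\<lambda>k. \<integral>\<^sup>+ u\<in>{0..t}. ennreal ((norm (f k u - \<phi> u))\<^sup>2) \<partial>lborel"
      let ?G = "\<lambda>k. \<integral>\<^sup>+ u\<in>{0..s}. ennreal ((norm (g k u - \<phi> u))\<^sup>2) \<partial>lborel"
      have "(\<lambda>k. ennreal 2 * ?F k + ennreal 2 * ?G k) \<longlonglongrightarrow> ennreal 2 * 0 + ennreal 2 * 0"
        by (intro tendsto_add ennreal_tendsto_cmult limf limg) auto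
      then show "(\<lambda>k. ennreal 2 * ?F k + ennreal 2 * ?G k) \<longlonglongrightarrow> 0" by simp
      have "(\<integral>\<^sup>+ u\<in>{0<..s}. ennreal ((norm (f k u - g k u - 0))\<^sup>2) \<partial>lborel) \<le> ennreal 2 * ?F k + ennreal 2 * ?G k" for k
      proof -
        have "ennreal ((norm (f k u - g k u - 0))\<^sup>2) * indicator {0<..s} u
            \<le> ennreal 2 * (ennreal ((norm (f k u - \<phi> u))\<^sup>2) * indicator {0..t} u)
              + ennreal 2 * (ennreal ((norm (g k u - \<phi> u))\<^sup>2) * indicator {0..s} u)" for u
        proof (cases "u \<in> {0<..s}")
          case True
          have "norm (f k u - g k u) \<le> norm (f k u - \<phi> u) + norm (g k u - \<phi> u)"
            using norm_triangle_ineq4[of "f k u - \<phi> u" "g k u - \<phi> u"] by simp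
          then have "(norm (f k u - g k u))\<^sup>2 \<le> (norm (f k u - \<phi> u) + norm (g k u - \<phi> u))\<^sup>2"
            by (intro power_mono) auto
          also have "\<dots> \<le> 2 * (norm (f k u - \<phi> u))\<^sup>2 + 2 * (norm (g k u - \<phi> u))\<^sup>2"
            using sum_squares_bound[of "norm (f k u - \<phi> u)" "norm (g k u - \<phi> u)"] by (simp add: power2_sum)
          finally have "ennreal ((norm (f k u - g k u))\<^sup>2)
              \<le> ennreal 2 * ennreal ((norm (f k u - \<phi> u))\<^sup>2) + ennreal 2 * ennreal ((norm (g k u - \<phi> u))\<^sup>2)"
            by (subst (1 2) ennreal_mult[symmetric], simp_all only: ennreal_plus[symmetric] zero_le_power2
              mult_nonneg_nonneg zero_le_numeral ennreal_leI)
          then show ?thesis using True st by simp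
        qed simp
        then have "(\<integral>\<^sup>+ u\<in>{0<..s}. ennreal ((norm (f k u - g k u - 0))\<^sup>2) \<partial>lborel)
          \<le> (\<integral>\<^sup>+ u. ennreal 2 * (ennreal ((norm (f k u - \<phi> u))\<^sup>2) * indicator {0..t} u)
              + ennreal 2 * (ennreal ((norm (g k u - \<phi> u))\<^sup>2) * indicator {0..s} u) \<partial>lborel)"
          by (intro nn_integral_mono)
        also have "\<dots> = ennreal 2 * ?F k + ennreal 2 * ?G k"
          by (subst nn_integral_add, measurable, subst (1 2) nn_integral_cmult, measurable)
        finally show ?thesis .
      qed
      then show "\<forall>\<^sub>F k in sequentially. (\<integral>\<^sup>+ u\<in>{0<..s}. ennreal ((norm (f k u - g k u - 0))\<^sup>2) \<partial>lborel)
          \<le> ennreal 2 * ?F k + ennreal 2 * ?G k"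
        by (intro always_eventually allI)
    qed simp
  qed (use elementary_integrable[OF elementary_diff[OF elZ elW] order_refl st(1)] in \<open>auto simp: set_integrable_def\<close>)

  have Zs_meas: "Z k s \<in> borel_measurable (F s)" and Ws_meas: "W k s \<in> borel_measurable (F s)" for k
    using elementary_adapted[OF elZ order_refl st(1)] elementary_adapted[OF elW order_refl st(1)]
    by (simp_all add: Z0 W0)
  have Zt_meas [measurable]: "Z k t \<in> borel_measurable M" for k
    by (rule measurable_filtration[OF t]) (use elementary_adapted[OF elZ order_refl t] in \<open>simp add: Z0\<close>)
  note [measurable] = measurable_filtration[OF st(1) Zs_meas] measurable_filtration[OF st(1) Ws_meas]

  \<comment> \<open>With V = 1 the characteristic function is the exponential of an integral tending
    to that of Psi(0) = 0.\<close>
  have U1: "(\<lambda>k. \<integral>\<omega>. iexp (Z k s \<omega> - W k s \<omega>) \<partial>M) \<longlonglongrightarrow> 1"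
  proof -
    have "(\<integral>\<omega>. iexp (Z k s \<omega> - W k s \<omega>) \<partial>M) = exp (LINT u:{0<..s}|lborel. ?\<psi> (f k u - g k u))" for k
      using elementary_char[OF elementary_diff[OF elZ elW] order_refl st(1), of "\<lambda>_. 1" 1 k k]
      by (simp add: Z0 W0 prob_space)
    then show ?thesis using tendsto_exp[OF limU] by simp
  qed
  define c where "c = op_exp (t *\<^sub>R C) Y0 \<bullet> x"
  \<comment> \<open>S(t) = S(t - s) S(s): the initial value contributes equally to Y(t) tested
    against x and to Y(s) tested against x'.\<close>
  have c: "op_exp (s *\<^sub>R C) Y0 \<bullet> x' = c"
    using op_exp_add[of "t - s" s C] by (simp add: c_def x'_def blinfun_adjoint[symmetric])
  \<comment> \<open>Each d k is F_s-measurable; its L1 limit e is a version of the exponential of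
    Y(s), built from J, which is only known to be measurable for M.\<close>
  define d where "d k \<omega> = iexp (c + Z k s \<omega>)" for k \<omega>
  define e where "e \<omega> = iexp (c + J \<omega> \<bullet> x')" for \<omega>
  have d_meas: "d k \<in> borel_measurable (F s)" for k
    unfolding d_def[abs_def] using Zs_meas[of k] by measurable
  note [measurable] = measurable_filtration[OF st(1) d_meas]
  have [measurable]: "e \<in> borel_measurable M" unfolding e_def[abs_def] by measurable
  have limd: "(\<lambda>k. \<integral>\<^sup>+ \<omega>. ennreal (cmod (d k \<omega> - e \<omega>)) \<partial>M) \<longlonglongrightarrow> 0"
  proof (rule tendsto_sandwich[OF _ _ tendsto_const])
    let ?U = "\<lambda>k. \<integral>\<^sup>+ \<omega>. ennreal (cmod (iexp (Z k s \<omega> - W k s \<omega>) - 1)) \<partial>M"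
    let ?V = "\<lambda>k. \<integral>\<^sup>+ \<omega>. ennreal (cmod (iexp (c + W k s \<omega>) - e \<omega>)) \<partial>M"
    have "?U \<longlonglongrightarrow> 0" by (rule iexp_tendsto_1_L1[OF _ U1]) measurable
    moreover have "?V \<longlonglongrightarrow> 0"
      unfolding e_def Ws by (rule iexp_inner_L1[OF _ _ BJ]) (auto intro: step_integral_measurable[OF q])
    ultimately have "(\<lambda>k. ?U k + ?V k) \<longlonglongrightarrow> 0 + 0" by (rule tendsto_add)
    then show "(\<lambda>k. ?U k + ?V k) \<longlonglongrightarrow> 0" by simp
    have "cmod (d k \<omega> - e \<omega>) \<le> cmod (iexp (Z k s \<omega> - W k s \<omega>) - 1) + cmod (iexp (c + W k s \<omega>) - e \<omega>)" for k \<omega>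
    proof -
      \<comment> \<open>A unimodular factor splits off, leaving one term that compares the two
        approximating sequences and one for the convergence of W k s to the J term.\<close>
      have "d k \<omega> - e \<omega> = iexp (c + W k s \<omega>) * (iexp (Z k s \<omega> - W k s \<omega>) - 1) + (iexp (c + W k s \<omega>) - e \<omega>)"
        by (simp add: d_def algebra_simps flip: exp_add)
      also have "cmod \<dots> \<le> cmod (iexp (c + W k s \<omega>) * (iexp (Z k s \<omega> - W k s \<omega>) - 1)) + cmod (iexp (c + W k s \<omega>) - e \<omega>)"
        by (rule norm_triangle_ineq)
      also have "cmod (iexp (c + W k s \<omega>) * (iexp (Z k s \<omega> - W k s \<omega>) - 1)) = cmod (iexp (Z k s \<omega> - W k s \<omega>) - 1)"
        unfolding norm_mult norm_exp_i_times by simp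
      finally show ?thesis .
    qed
    then have "(\<integral>\<^sup>+ \<omega>. ennreal (cmod (d k \<omega> - e \<omega>)) \<partial>M)
        \<le> (\<integral>\<^sup>+ \<omega>. ennreal (cmod (iexp (Z k s \<omega> - W k s \<omega>) - 1)) + ennreal (cmod (iexp (c + W k s \<omega>) - e \<omega>)) \<partial>M)" for k
      by (intro nn_integral_mono) (simp add: ennreal_plus[symmetric] ennreal_leI del: ennreal_plus)
    also have "\<dots> k = ?U k + ?V k" for k
      by (subst nn_integral_add) auto
    finally show "\<forall>\<^sub>F k in sequentially. (\<integral>\<^sup>+ \<omega>. ennreal (cmod (d k \<omega> - e \<omega>)) \<partial>M) \<le> ?U k + ?V k"
      by (intro always_eventually allI)
  qed simp
  define h where "h k \<omega> = iexp (c + Z k t \<omega>)" for k \<omega>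
  define X where "X \<omega> = iexp (c + I \<omega> \<bullet> x)" for \<omega>
  have [measurable]: "h k \<in> borel_measurable M" "X \<in> borel_measurable M" for k
    unfolding h_def[abs_def] X_def[abs_def] by measurable
  have limh: "(\<lambda>k. \<integral>\<^sup>+ \<omega>. ennreal (cmod (h k \<omega> - X \<omega>)) \<partial>M) \<longlonglongrightarrow> 0"
    unfolding h_def X_def Zt by (rule iexp_inner_L1[OF _ _ AI]) (auto intro: step_integral_measurable[OF p])

  have norm1: "cmod (d k \<omega>) = 1" "cmod (e \<omega>) = 1" "cmod (h k \<omega>) = 1" "cmod (X \<omega>) = 1" for k \<omega>
    unfolding d_def e_def h_def X_def by (rule norm_exp_i_times)+
  \<comment> \<open>Modulus one supplies integrability, and an indicator does not increase the L1
    distance.\<close>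
  have int_ind: "(\<lambda>k. \<integral>\<omega>. indicator G \<omega> * u k \<omega> \<partial>M) \<longlonglongrightarrow> (\<integral>\<omega>. indicator G \<omega> * v \<omega> \<partial>M)"
    if [measurable]: "G \<in> sets M" "\<And>k. u k \<in> borel_measurable M" "v \<in> borel_measurable M"
      and bdd: "\<And>k \<omega>. cmod (u k \<omega>) = 1" "\<And>\<omega>. cmod (v \<omega>) = 1"
      and lim: "(\<lambda>k. \<integral>\<^sup>+ \<omega>. ennreal (cmod (u k \<omega> - v \<omega>)) \<partial>M) \<longlonglongrightarrow> 0"
    for G and u :: "nat \<Rightarrow> 'w \<Rightarrow> complex" and v
  proof (rule tendsto_L1_int)
    show "integrable M (\<lambda>\<omega>. indicator G \<omega> * u k \<omega>)" for k
      by (rule integrable_const_bound[of _ 1]) (auto simp: norm_mult bdd indicator_def)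
    show "integrable M (\<lambda>\<omega>. indicator G \<omega> * v \<omega>)"
      by (rule integrable_const_bound[of _ 1]) (auto simp: norm_mult bdd indicator_def)
    show "(\<lambda>k. \<integral>\<^sup>+ \<omega>. ennreal (norm (indicator G \<omega> * u k \<omega> - indicator G \<omega> * v \<omega>)) \<partial>M) \<longlonglongrightarrow> 0"
      by (rule tendsto_sandwich[OF _ _ tendsto_const lim])
        (auto intro!: always_eventually nn_integral_mono simp: indicator_def)
  qed
  \<comment> \<open>For step integrands this is \<open>elementary_char\<close> on (s, t] with V the
    indicator of G times d k; both sides then pass to the limit.\<close>
  have factor: "(\<integral>\<omega>. indicator G \<omega> * X \<omega> \<partial>M) = (\<integral>\<omega>. indicator G \<omega> * (e \<omega> * exp K) \<partial>M)"
    if G: "G \<in> sets (F s)" for G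
  proof -
    have GM: "G \<in> sets M" using G subalgebra_filtration[OF st(1)] by (auto simp: subalgebra_def)
    have "(\<integral>\<omega>. indicator G \<omega> * h k \<omega> \<partial>M)
        = (\<integral>\<omega>. indicator G \<omega> * d k \<omega> \<partial>M) * exp (LINT u:{s<..t}|lborel. ?\<psi> (f k u))" for k
    proof -
      have "(\<integral>\<omega>. indicator G \<omega> * h k \<omega> \<partial>M) = (\<integral>\<omega>. indicator G \<omega> * d k \<omega> * iexp (Z k t \<omega> - Z k s \<omega>) \<partial>M)"
        by (simp add: h_def d_def mult.assoc algebra_simps flip: exp_add)
      also have "\<dots> = (\<integral>\<omega>. indicator G \<omega> * d k \<omega> \<partial>M) * exp (LINT u:{s<..t}|lborel. ?\<psi> (f k u))"
      proof (rule elementary_char[OF elZ st])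
        show "(\<lambda>\<omega>. indicator G \<omega> * d k \<omega>) \<in> borel_measurable (F s)" using G d_meas[of k] by measurable
        show "cmod (indicator G \<omega> * d k \<omega>) \<le> 1" for \<omega> by (simp add: norm_mult norm1 indicator_def)
      qed
      finally show ?thesis .
    qed
    moreover have "(\<lambda>k. \<integral>\<omega>. indicator G \<omega> * h k \<omega> \<partial>M) \<longlonglongrightarrow> (\<integral>\<omega>. indicator G \<omega> * X \<omega> \<partial>M)"
      by (rule int_ind[OF GM _ _ _ _ limh]) (auto simp: norm1)
    moreover have "(\<lambda>k. (\<integral>\<omega>. indicator G \<omega> * d k \<omega> \<partial>M) * exp (LINT u:{s<..t}|lborel. ?\<psi> (f k u)))
        \<longlonglongrightarrow> (\<integral>\<omega>. indicator G \<omega> * e \<omega> \<partial>M) * exp K"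
      by (intro tendsto_mult tendsto_exp limK int_ind[OF GM _ _ _ _ limd]) (auto simp: norm1)
    ultimately have "(\<integral>\<omega>. indicator G \<omega> * X \<omega> \<partial>M) = (\<integral>\<omega>. indicator G \<omega> * e \<omega> \<partial>M) * exp K"
      using LIMSEQ_unique by simp
    then show ?thesis by (simp add: mult.assoc flip: integral_mult_left_zero)
  qed

  \<comment> \<open>L1 convergence gives almost everywhere convergence along a subsequence. On the
    exceptional set \<open>lim\<close> takes some fixed value, so the pointwise limit is defined
    everywhere and stays F_s-measurable.\<close>
  obtain r where "AE \<omega> in M. (\<lambda>k. d (r k) \<omega> - e \<omega>) \<longlonglongrightarrow> 0"
  proof -
    have "integrable M (\<lambda>\<omega>. d k \<omega> - e \<omega>)" for k
      by (intro Bochner_Integration.integrable_diff; rule integrable_const_bound[of _ 1]) (auto simp: norm1)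
    moreover from this have "(\<lambda>k. \<integral>\<omega>. norm (d k \<omega> - e \<omega>) \<partial>M) \<longlonglongrightarrow> 0"
      using limd by (simp add: nn_integral_eq_integral ennreal_tendsto_0_iff)
    ultimately show ?thesis using tendsto_L1_AE_subseq[of M "\<lambda>k \<omega>. d k \<omega> - e \<omega>"] that by blast
  qed
  then have e_lim: "AE \<omega> in M. e \<omega> = lim (\<lambda>k. d (r k) \<omega>)"
    by eventually_elim (simp add: limI LIM_zero_iff)
  have lim_meas: "(\<lambda>\<omega>. lim (\<lambda>k. d (r k) \<omega>)) \<in> borel_measurable (F s)"
    by (rule borel_measurable_lim_metric) (rule d_meas)

  interpret finite_measure_subalgebra M "F s"
    by unfold_locales (rule subalgebra_filtration[OF st(1)])
  have XY: "AE \<omega> in M. iexp (Y t \<omega> \<bullet> x) = X \<omega>"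
    using Yt by eventually_elim (simp add: X_def c_def inner_add_left)
  \<comment> \<open>Time reversal u -> t - u of the exponent over (s, t].\<close>
  have K: "K = (LINT u:{0..t - s}|lborel. ?\<psi> (adjoint (op_exp (u *\<^sub>R C)) x))"
    unfolding K_def \<phi>_def
    by (intro set_integral_reflect borel_measurable_continuous_onI continuous_on_compose2[OF
        continuous_levy_exponent[OF levy_measure] continuous_adjoint_op_exp]) simp
  have "AE \<omega> in M. complex_cond_exp M (F s) (\<lambda>\<omega>. iexp (Y t \<omega> \<bullet> x)) \<omega> = e \<omega> * exp K"
  proof (rule complex_cond_exp_charact)
    show "integrable M (\<lambda>\<omega>. iexp (Y t \<omega> \<bullet> x))" by (rule integrable_const_bound[of _ 1]) auto
    show "integrable M (\<lambda>\<omega>. e \<omega> * exp K)"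
      by (rule integrable_const_bound[of _ "cmod (exp K)"]) (auto simp: norm_mult norm1 simp del: norm_exp_eq_Re)
    show "(\<lambda>\<omega>. lim (\<lambda>k. d (r k) \<omega>) * exp K) \<in> borel_measurable (F s)" using lim_meas by measurable
    show "AE \<omega> in M. e \<omega> * exp K = lim (\<lambda>k. d (r k) \<omega>) * exp K" using e_lim by eventually_elim simp
    fix G assume G: "G \<in> sets (F s)"
    then have [measurable]: "G \<in> sets M" using subalg by (auto simp: subalgebra_def)
    have "(\<integral>\<omega>. indicator G \<omega> * iexp (Y t \<omega> \<bullet> x) \<partial>M) = (\<integral>\<omega>. indicator G \<omega> * X \<omega> \<partial>M)"
      by (rule integral_cong_AE) (use XY in auto)
    with factor[OF G] show "(\<integral>\<omega>. indicator G \<omega> * iexp (Y t \<omega> \<bullet> x) \<partial>M) = (\<integral>\<omega>. indicator G \<omega> * (e \<omega> * exp K) \<partial>M)"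
      by simp
  qed
  moreover have "AE \<omega> in M. e \<omega> = iexp (Y s \<omega> \<bullet> x')"
    using Ys by eventually_elim (simp add: e_def inner_add_left c)
  ultimately show ?thesis
    unfolding x'_def[symmetric] K[symmetric] by eventually_elim (simp add: exp_add)
qed

end

theorem proposition2p5:
  fixes M :: "'w measure" and F :: "real \<Rightarrow> 'w measure"
    and C Q :: "'h::{real_inner,banach,second_countable_topology} hs \<Rightarrow>\<^sub>L 'h hs"
    and L Y :: "real \<Rightarrow> 'w \<Rightarrow> 'h hs"
    and Y0 D T :: "'h hs" and \<nu> :: "'h hs measure" and s t :: real
  assumes "prob_space M" and "filtered M F"
    and "levy_process M F L" and "square_integrable_process M L"
    and "characteristic_triplet M L D Q \<nu>"
    and "mild_solution M C L Y0 Y"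
    and "0 \<le> s" and "s \<le> t"
  shows "AE \<omega> in M. complex_cond_exp M (F s) (\<lambda>\<omega>. iexp (Y t \<omega> \<bullet> T)) \<omega> =
    exp (\<i> * complex_of_real (Y s \<omega> \<bullet> adjoint (op_exp ((t - s) *\<^sub>R C)) T) +
         (LINT u:{0..t - s}|lborel. levy_exponent D Q \<nu> (adjoint (op_exp (u *\<^sub>R C)) T)))"
proof -
  interpret prob_space M by fact
  \<comment> \<open>The Hilbert-Schmidt operators form a separable Hilbert space by the class
    instances of \<open>hs\<close>, so the general setting applies.\<close>
  interpret levy_triplet M F L D Q \<nu>
    by unfold_locales fact+
  show ?thesis by (rule mild_solution_char) fact+
qed

end
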